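(* There exist constants $C,C',c>0$ and a sequence $\{\Psi_n\}_{n\ge1}$ of compactly supported functions in $L^2(\mathbb{R}^+)$ such that, for all $n$, $\|\Psi_n\|_2<C$ and $$|\{\xi\in\mathbb{R}:\mathfrak{M}(\xi,\Psi_n)\ge C'\log n\}|\ge c.$$ Hence the weak-type estimate for $\mathfrak{M}$ fails: there is no constant $K<\infty$ such that $|\{\xi\in\mathbb{R}:\mathfrak{M}(\xi,A)\ge\lambda\}|\le K\|A\|_2/\lambda$ for all $\lambda>0$ and all $A\in L^2(\mathbb{R}^+)$.
   Context: $\mathbb{R}^+=[0,\infty)$, $\mathbb{C}^+=\{k\in\mathbb{C}:\operatorname{Im}k>0\}$, $|E|$ is Lebesgue measure of $E\subset\mathbb{R}$. For a complex-valued $A\in L^1_{\rm loc}(\mathbb{R}^+)$ and $k\in\mathbb{C}$, let $X(x,k,A)$ be the $2\times2$ fundamental matrix of the Krein system $$\partial_xX=\begin{pmatrix} ik&-\overline{A(x)}\\-A(x)&0\end{pmatrix}X,\qquad X(0,k,A)=\begin{pmatrix}1&0\\0&1\end{pmatrix},\qquad x\ge0,$$ and define $\mathfrak{A}(x,k,A):=X_{22}(x,k,A)$. For each $x$, $\mathfrak{A}(x,\cdot,A)$ is entire, satisfies $|\mathfrak{A}|\ge1$ on $\overline{\mathbb{C}^+}$, and is outer in $\mathbb{C}^+$. Its argument is the imaginary part of the branch of $\log\mathfrak{A}$ that vanishes at infinity, i.e. $$\arg\mathfrak{A}(x,k,A)=\operatorname{Im}\Bigl(\frac1{\pi i}\int_{\mathbb{R}}\frac{\log|\mathfrak{A}(x,s,A)|}{s-k}\,ds\Bigr),\qquad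 k\in\mathbb{C}^+.$$ For $\xi\in\mathbb{R}$ let $S_\xi=\{k\in\mathbb{C}^+:|\operatorname{Re}k-\xi|<\operatorname{Im}k\}$ be the Stolz angle at $\xi$, and put $$\mathfrak{M}(\xi,A)=\sup_{k\in S_\xi,\,x\in\mathbb{R}^+}|\arg\mathfrak{A}(x,k,A)|.$$ *)

theory Defs
  imports "HOL-Analysis.Analysis"
begin

text \<open>
  Functions on the half-line $[0,\infty)$ are represented by functions on all of \<^typ>\<open>real\<close>;
  nothing below depends on their values at negative arguments.
\<close>

definition L2_halfline :: "(real \<Rightarrow> complex) set" where
  "L2_halfline = {A. set_borel_measurable lebesgue {0..} A \<and>
                     set_integrable lebesgue {0..} (\<lambda>x. (cmod (A x))\<^sup>2)}"

definition L2_halfline_norm :: "(real \<Rightarrow> complex) \<Rightarrow> real" where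
  "L2_halfline_norm A = sqrt (LINT x:{0..}|lebesgue. (cmod (A x))\<^sup>2)"

definition compactly_supported_halfline :: "(real \<Rightarrow> complex) \<Rightarrow> bool" where
  "compactly_supported_halfline A \<longleftrightarrow> compact (closure {x \<in> {0..}. A x \<noteq> 0})"

definition krein_matrix :: "(real \<Rightarrow> complex) \<Rightarrow> complex \<Rightarrow> real \<Rightarrow> complex^2^2" where
  "krein_matrix A k x = vector [vector [\<i> * k, - cnj (A x)],
                                vector [- A x,  0]]"

text \<open>
  The coefficient \<open>A\<close> is only locally integrable, so the Krein system is understood in the
  sense of Caratheodory: the initial value problem is equivalent to its integrated form,
  whose solutions are exactly the locally absolutely continuous functions that satisfy the
  differential equation almost everywhere and the initial condition.
\<close>

definition krein_solution ::
    "(real \<Rightarrow> complex) \<Rightarrow> complex \<Rightarrow> (real \<Rightarrow> complex^2^2) \<Rightarrow> bool" where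
  "krein_solution A k X \<longleftrightarrow>
     continuous_on {0..} X \<and>
     (\<forall>x\<ge>0. set_integrable lebesgue {0..x} (\<lambda>t. krein_matrix A k t ** X t) \<and>
             X x = mat 1 + (LINT t:{0..x}|lebesgue. krein_matrix A k t ** X t))"

text \<open>
  For locally integrable \<open>A\<close> a solution exists and is unique on $[0,\infty)$, so the choice
  below is immaterial for \<open>x \<ge> 0\<close>.
\<close>

definition krein_X :: "real \<Rightarrow> complex \<Rightarrow> (real \<Rightarrow> complex) \<Rightarrow> complex^2^2" where
  "krein_X x k A = (SOME X. krein_solution A k X) x"

definition krein_frakA :: "real \<Rightarrow> complex \<Rightarrow> (real \<Rightarrow> complex) \<Rightarrow> complex" where
  "krein_frakA x k A = krein_X x k A $ 2 $ 2"

text \<open>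
  The argument is not the principal one: it is the imaginary part of the branch of the
  logarithm of \<^const>\<open>krein_frakA\<close> in the upper half-plane that vanishes at infinity, given by
  its Schwarz integral.  For \<open>A\<close> in \<^const>\<open>L2_halfline\<close> the integral converges absolutely.
\<close>

definition arg_frakA :: "real \<Rightarrow> complex \<Rightarrow> (real \<Rightarrow> complex) \<Rightarrow> real" where
  "arg_frakA x k A =
     Im (1 / (complex_of_real pi * \<i>) *
         (LINT s|lebesgue. complex_of_real (ln (cmod (krein_frakA x (complex_of_real s) A)))
                            / (complex_of_real s - k)))"

definition stolz_angle :: "real \<Rightarrow> complex set" where
  "stolz_angle \<xi> = {k. Im k > 0 \<and> \<bar>Re k - \<xi>\<bar> < Im k}"

text \<open>The supremum may be infinite, so it is taken in the extended reals.\<close>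

definition frakM :: "real \<Rightarrow> (real \<Rightarrow> complex) \<Rightarrow> ereal" where
  "frakM \<xi> A = (SUP (k, x) \<in> stolz_angle \<xi> \<times> {0..}. ereal \<bar>arg_frakA x k A\<bar>)"

end

theory Submission
  imports Defs "HOL-Probability.Sinc_Integral"
begin

text \<open>Since arg is a Schwarz integral over the line, only real s matter. There the Krein flow
  keeps |X_22|^2 - |X_12|^2 equal to 1, so log |X_22| is half of log (1 + |X_12|^2), and upper and
  lower bounds for X_12 suffice. The obstacle is the length of the evolution. In the rescaled time u
  = x/\<nu> the coupling is the constant \<open>e\<close>, but u runs up to \<nu>, so a Gronwall
  bound exp (e \<nu>) is worthless except on windows of bounded length. Away from the resonance u =
  \<nu> s the fast rotation must be exploited: after subtraction of the adiabatic value the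
  remaining forcing has size e/(\<nu> s - u)^2, which is integrable up to infinity. Inside the
  window |u - \<nu> s| \<le> R the jump of X_12 is e times a Fresnel integral, up to an error 5 e/R
  + 8 R^2 e^2. This fixes the order of choices: R large enough for the tails, then e small against
  1/R^2. With R = 1000 and e = 10^-8 a size of at least e/5 survives at all later times.\<close>

text \<open>
  The potential is a chirp \<open>\<Psi>(t) = (e/\<nu>) exp(- i t\<^sup>2 / (2 \<nu>\<^sup>2))\<close> on \<open>[0, \<nu>\<^sup>2]\<close> with a small
  fixed \<open>e\<close>, which is also its $L^2$ norm, and \<open>\<nu>\<close> proportional to \<open>n\<close>.  Its local frequency meets
  the spectral parameter \<open>s\<close> at time \<open>\<nu>\<^sup>2 s\<close>, so that at time \<open>x = \<nu>\<^sup>2 \<xi>\<close> the function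
  \<open>s \<mapsto> log |\<AA>(x, s)|\<close> resembles a multiple of the indicator of \<open>[0, \<xi>]\<close>, smoothed at scale
  \<open>1/\<nu>\<close>: it is bounded below to the left of \<open>\<xi>\<close> and decays like \<open>1/(\<nu>(s - \<xi>))\<^sup>2\<close> to the right.  The
  conjugate function of such a jump has size \<open>log \<nu>\<close> at \<open>\<xi> + i/\<nu>\<close>, and this happens for every
  \<open>\<xi> \<in> [1/2, 1]\<close>, each at its own \<open>x\<close>.
\<close>

subsection \<open>Monotonicity and Fresnel integrals\<close>

text \<open>Stands in for Gronwall's inequality below: each differential inequality becomes the
  monotonicity of an energy times an integrating factor. Derivatives within the closed interval
  match the one-sided derivatives of the system at its end points.\<close>

lemma has_real_derivative_nonneg_imp_le:
  fixes f :: "real \<Rightarrow> real"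
  assumes "p \<le> q"
    and der: "\<And>t. t \<in> {p..q} \<Longrightarrow> (f has_real_derivative f' t) (at t within {p..q})"
    and nonneg: "\<And>t. t \<in> {p..q} \<Longrightarrow> 0 \<le> f' t"
  shows "f p \<le> f q"
proof (rule DERIV_nonneg_imp_increasing_open[OF \<open>p \<le> q\<close>])
  fix t assume t: "p < t" "t < q"
  then have "(f has_real_derivative f' t) (at t)"
    using der[of t] at_within_Icc_at[of p t q] by simp
  then show "\<exists>y. (f has_real_derivative y) (at t) \<and> 0 \<le> y"
    using nonneg[of t] t by auto
next
  show "continuous_on {p..q} f"
    using der by (meson DERIV_continuous continuous_on_eq_continuous_within)
qed

lemma has_real_derivative_nonpos_imp_ge:
  fixes f :: "real \<Rightarrow> real"
  assumes "p \<le> q"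
    and der: "\<And>t. t \<in> {p..q} \<Longrightarrow> (f has_real_derivative f' t) (at t within {p..q})"
    and nonpos: "\<And>t. t \<in> {p..q} \<Longrightarrow> f' t \<le> 0"
  shows "f q \<le> f p"
  using has_real_derivative_nonneg_imp_le[of p q "\<lambda>t. - f t" "\<lambda>t. - f' t"] assms
  by (auto intro: DERIV_minus)

lemma has_real_derivative_cmod_power2:
  assumes "(f has_vector_derivative f') (at t within S)"
  shows "((\<lambda>t. (cmod (f t))\<^sup>2) has_real_derivative 2 * Re (cnj (f t) * f')) (at t within S)"
proof -
  have "((\<lambda>t. inner (f t) (f t)) has_vector_derivative (inner (f t) f' + inner f' (f t))) (at t within S)"
    using bounded_bilinear.has_vector_derivative[OF bounded_bilinear_inner assms assms] .
  then show ?thesis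
    by (simp add: has_real_derivative_iff_has_vector_derivative power2_norm_eq_inner)
      (simp add: inner_complex_def algebra_simps)
qed

lemma norm_diff_le_if_vector_derivative_bounded:
  fixes f :: "real \<Rightarrow> 'a::real_normed_vector"
  assumes "p \<le> q"
    and der: "\<And>t. t \<in> {p..q} \<Longrightarrow> (f has_vector_derivative f' t) (at t within {p..q})"
    and B: "\<And>t. t \<in> {p..q} \<Longrightarrow> norm (f' t) \<le> B"
  shows "norm (f q - f p) \<le> B * (q - p)"
proof -
  have "norm (f q - f p) \<le> B * norm (q - p)"
  proof (rule differentiable_bound[of "{p..q}" f "\<lambda>t h. h *\<^sub>R f' t"])
    show "onorm (\<lambda>h. h *\<^sub>R f' t) \<le> B" if "t \<in> {p..q}" for t
      using B[OF that] by (intro onorm_le) (auto simp: mult.commute[of B] intro: mult_left_mono)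
  qed (use assms in \<open>auto simp: has_vector_derivative_def\<close>)
  then show ?thesis using \<open>p \<le> q\<close> by simp
qed

text \<open>On [0, 2] a Taylor bound for cos gives at least 6/5; beyond 2, integration by parts
  shows that the oscillating tail costs at most 1.\<close>

lemma fresnel_cos_lower_bound:
  assumes "2 \<le> (R::real)"
  shows "1/5 \<le> integral {0..R} (\<lambda>u. cos (u\<^sup>2/2))"
proof -
  define F where "F t = integral {0..t} (\<lambda>u::real. cos (u\<^sup>2/2))" for t
  have F: "(F has_real_derivative cos (t\<^sup>2/2)) (at t within {0..R})" if "t \<in> {0..R}" for t
    unfolding F_def has_real_derivative_iff_has_vector_derivative
    by (rule integral_has_vector_derivative[OF _ that]) (auto intro!: continuous_intros)
  \<comment> \<open>The polynomial \<open>t - t^5/40\<close> is the primitive of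
    \<open>1 - t^4/8\<close>, the second-order Taylor bound for cos at
    \<open>t\<^sup>2/2\<close>.\<close>
  have "F 0 - (0 - 0^5/40) \<le> F 2 - (2 - 2^5/40)"
  proof (rule has_real_derivative_nonneg_imp_le[where f = "\<lambda>t. F t - (t - t^5/40)"])
    fix t::real assume t: "t \<in> {0..2}"
    have "(F has_real_derivative cos (t\<^sup>2/2)) (at t within {0..2})"
      using F[of t] t assms by (auto intro: DERIV_subset)
    then show "((\<lambda>t. F t - (t - t^5/40)) has_real_derivative cos (t\<^sup>2/2) - (1 - t^4/8)) (at t within {0..2})"
      by (auto intro!: derivative_eq_intros)
    have "cos (t\<^sup>2/2) \<ge> 1 - (t\<^sup>2/2)\<^sup>2/2"
    proof -
      have "\<bar>sin (t\<^sup>2/4)\<bar> \<le> \<bar>t\<^sup>2/4\<bar>" by (rule abs_sin_x_le_abs_x)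
      then have "(sin (t\<^sup>2/4))\<^sup>2 \<le> (t\<^sup>2/4)\<^sup>2" by (simp only: abs_le_square_iff)
      moreover have "cos (t\<^sup>2/2) = 1 - 2 * (sin (t\<^sup>2/4))\<^sup>2"
        using cos_double_sin[of "t\<^sup>2/4"] by simp
      ultimately show ?thesis by (simp add: power_divide)
    qed
    then show "0 \<le> cos (t\<^sup>2/2) - (1 - t^4/8)" by (simp add: power_divide)
  qed simp
  then have F2: "6/5 \<le> F 2" by (simp add: F_def)
  \<comment> \<open>Integration by parts: \<open>sin (t\<^sup>2/2)/t\<close> has derivative cos
    (t^2/2) - sin (t^2/2)/t^2, and the term \<open>1/t\<close> makes up for the sign of the
    remainder.\<close>
  have "F 2 - sin (2\<^sup>2/2)/2 - 1/2 \<le> F R - sin (R\<^sup>2/2)/R - 1/R"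
  proof (rule has_real_derivative_nonneg_imp_le[where f = "\<lambda>t. F t - sin (t\<^sup>2/2)/t - 1/t"])
    fix t::real assume t: "t \<in> {2..R}"
    have "(F has_real_derivative cos (t\<^sup>2/2)) (at t within {2..R})"
      using F[of t] t by (auto intro: DERIV_subset)
    then show "((\<lambda>t. F t - sin (t\<^sup>2/2)/t - 1/t) has_real_derivative (sin (t\<^sup>2/2) + 1)/t\<^sup>2) (at t within {2..R})"
      using t by (auto intro!: derivative_eq_intros simp: field_simps power2_eq_square)
    have "0 \<le> sin (t\<^sup>2/2) + 1"
      using sin_ge_minus_one[of "t\<^sup>2/2"] by linarith
    then show "0 \<le> (sin (t\<^sup>2/2) + 1)/t\<^sup>2" by simp
  qed (use assms in simp)
  moreover have "sin (R\<^sup>2/2)/R + 1/R \<ge> 0"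
  proof -
    have "0 \<le> sin (R\<^sup>2/2) + 1"
      using sin_ge_minus_one[of "R\<^sup>2/2"] by linarith
    then have "0 \<le> (sin (R\<^sup>2/2) + 1) / R" using assms by simp
    then show ?thesis by (simp only: add_divide_distrib)
  qed
  moreover have "sin (2\<^sup>2/2 :: real) \<le> 1" by simp
  ultimately show ?thesis using F2 unfolding F_def by linarith
qed

lemma fresnel_symmetric_lower_bound:
  assumes "2 \<le> (R::real)"
  shows "2/5 \<le> cmod (integral {-R..R} (\<lambda>u. cis (u\<^sup>2/2)))"
proof -
  have int: "(\<lambda>u::real. cis (u\<^sup>2/2)) integrable_on {-R..R}"
    by (intro integrable_continuous_interval continuous_intros) auto
  have cint: "(\<lambda>u::real. cos (u\<^sup>2/2)) integrable_on {a..b}" for a b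
    by (intro integrable_continuous_interval continuous_intros) auto
  have "Re (integral {-R..R} (\<lambda>u. cis (u\<^sup>2/2))) = integral {-R..R} (\<lambda>u. cos (u\<^sup>2/2))"
    using integral_linear[OF int bounded_linear_Re] by (simp add: o_def)
  also have "\<dots> = integral {-R..0} (\<lambda>u. cos (u\<^sup>2/2)) + integral {0..R} (\<lambda>u. cos (u\<^sup>2/2))"
    using assms by (intro Henstock_Kurzweil_Integration.integral_combine[symmetric] cint) auto
  also have "integral {-R..0} (\<lambda>u. cos (u\<^sup>2/2)) = integral {0..R} (\<lambda>u. cos (u\<^sup>2/2))"
    using Henstock_Kurzweil_Integration.integral_reflect_real[of R 0 "\<lambda>u. cos (u\<^sup>2/2)"] by simp
  finally have "2/5 \<le> Re (integral {-R..R} (\<lambda>u. cis (u\<^sup>2/2)))"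
    using fresnel_cos_lower_bound[OF assms] by simp
  then show ?thesis using complex_Re_le_cmod order_trans by blast
qed

subsection \<open>The Landau--Zener system\<close>

text \<open>A two-level system swept linearly through resonance at time \<open>\<kappa>\<close>.
  Both couplings carry the same sign, so the symmetry is hyperbolic, unlike in the unitary
  Landau-Zener model. In the application \<open>\<kappa>\<close> is \<nu> s, \<open>L\<close> is
  \<nu>, \<open>a\<close> is X_22 and \<open>\<beta>\<close> is X_12 up to a phase.\<close>

locale landau_zener =
  fixes e \<kappa> L :: real and \<beta> a :: "real \<Rightarrow> complex"
  assumes e_pos: "0 < e" and e_le: "e \<le> 1/16"
    and deriv_\<beta>: "\<And>t. t \<in> {0..L} \<Longrightarrow>
      (\<beta> has_vector_derivative (\<i> * of_real (\<kappa> - t) * \<beta> t - of_real e * a t)) (at t within {0..L})"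
    and deriv_a: "\<And>t. t \<in> {0..L} \<Longrightarrow>
      (a has_vector_derivative (- of_real e * \<beta> t)) (at t within {0..L})"
    and init_\<beta>: "\<beta> 0 = 0" and init_a: "a 0 = 1"
begin

lemma deriv_\<beta>_sub:
  assumes "0 \<le> p" "q \<le> L" "t \<in> {p..q}"
  shows "(\<beta> has_vector_derivative (\<i> * of_real (\<kappa> - t) * \<beta> t - of_real e * a t)) (at t within {p..q})"
  by (rule has_vector_derivative_within_subset[OF deriv_\<beta>]) (use assms in auto)

lemma deriv_a_sub:
  assumes "0 \<le> p" "q \<le> L" "t \<in> {p..q}"
  shows "(a has_vector_derivative (- of_real e * \<beta> t)) (at t within {p..q})"
  by (rule has_vector_derivative_within_subset[OF deriv_a]) (use assms in auto)

section \<open>Conservation law and crude growth\<close>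

text \<open>The detuning is purely imaginary and drops out, and the two coupling terms contribute
  the same amount to the derivatives of |a|^2 and |\<beta>|^2. The difference is therefore
  constant.\<close>

lemma cmod_a_power2:
  assumes "t \<in> {0..L}"
  shows "(cmod (a t))\<^sup>2 = 1 + (cmod (\<beta> t))\<^sup>2"
proof -
  define f where "f t = (cmod (a t))\<^sup>2 - (cmod (\<beta> t))\<^sup>2" for t
  have f: "(f has_real_derivative 0) (at u within {0..t})" if u: "u \<in> {0..t}" for u
  proof -
    have "(f has_real_derivative (2 * Re (cnj (a u) * (- of_real e * \<beta> u))
        - 2 * Re (cnj (\<beta> u) * (\<i> * of_real (\<kappa> - u) * \<beta> u - of_real e * a u)))) (at u within {0..t})"
      unfolding f_def using assms u
      by (intro DERIV_diff[OF has_real_derivative_cmod_power2[OF deriv_a_sub]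
            has_real_derivative_cmod_power2[OF deriv_\<beta>_sub]]) auto
    also have "2 * Re (cnj (a u) * (- of_real e * \<beta> u))
        - 2 * Re (cnj (\<beta> u) * (\<i> * of_real (\<kappa> - u) * \<beta> u - of_real e * a u)) = 0"
      by (simp add: algebra_simps)
    finally show ?thesis .
  qed
  have "f 0 \<le> f t" "f t \<le> f 0"
    by (rule has_real_derivative_nonneg_imp_le[OF _ f] has_real_derivative_nonpos_imp_ge[OF _ f]; use assms in simp)+
  then show ?thesis by (simp add: f_def init_a init_\<beta>)
qed

lemma one_le_cmod_a: "t \<in> {0..L} \<Longrightarrow> 1 \<le> cmod (a t)"
  by (rule power2_le_imp_le) (auto simp: cmod_a_power2)

lemma cmod_\<beta>_le_cmod_a: "t \<in> {0..L} \<Longrightarrow> cmod (\<beta> t) \<le> cmod (a t)"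
  by (rule power2_le_imp_le) (auto simp: cmod_a_power2)

lemma cmod_a_le: "t \<in> {0..L} \<Longrightarrow> cmod (a t) \<le> 1 + cmod (\<beta> t)"
  by (rule power2_le_imp_le) (auto simp: cmod_a_power2 power2_sum)

text \<open>From |\<beta>| \<le> |a| the derivative of |a|^2 is at most 2 e |a|^2. As a quantitative
  bound this helps only on windows whose length is small compared with 1/e.\<close>

lemma cmod_a_growth:
  assumes "0 \<le> p" "p \<le> q" "q \<le> L"
  shows "(cmod (a q))\<^sup>2 \<le> (cmod (a p))\<^sup>2 * exp (2 * e * (q - p))"
proof -
  define f where "f t = (cmod (a t))\<^sup>2 * exp (- 2 * e * t)" for t
  define f' where "f' t = (2 * Re (cnj (a t) * (- of_real e * \<beta> t)) - 2 * e * (cmod (a t))\<^sup>2) * exp (- 2 * e * t)" for t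
  have "f q \<le> f p"
  proof (rule has_real_derivative_nonpos_imp_ge[OF \<open>p \<le> q\<close>])
    fix t assume t: "t \<in> {p..q}"
    have "((\<lambda>t. (cmod (a t))\<^sup>2) has_real_derivative 2 * Re (cnj (a t) * (- of_real e * \<beta> t))) (at t within {p..q})"
      by (rule has_real_derivative_cmod_power2, rule deriv_a_sub) (use assms t in auto)
    moreover have "((\<lambda>t. exp (- 2 * e * t)) has_real_derivative exp (- 2 * e * t) * (- 2 * e)) (at t within {p..q})"
      by (auto intro!: derivative_eq_intros)
    ultimately have "(f has_real_derivative (2 * Re (cnj (a t) * (- of_real e * \<beta> t)) * exp (- 2 * e * t)
        + exp (- 2 * e * t) * (- 2 * e) * (cmod (a t))\<^sup>2)) (at t within {p..q})"
      unfolding f_def by (rule DERIV_mult)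
    then show "(f has_real_derivative f' t) (at t within {p..q})"
      unfolding f'_def by (simp add: algebra_simps)
    have "Re (cnj (a t) * (- of_real e * \<beta> t)) \<le> cmod (cnj (a t) * (- of_real e * \<beta> t))"
      by (rule complex_Re_le_cmod)
    also have "\<dots> = e * (cmod (a t) * cmod (\<beta> t))"
      using e_pos by (simp add: norm_mult)
    also have "\<dots> \<le> e * (cmod (a t) * cmod (a t))"
      using e_pos t assms by (intro mult_left_mono cmod_\<beta>_le_cmod_a) auto
    finally show "f' t \<le> 0"
      unfolding f'_def by (auto simp: power2_eq_square mult_le_0_iff)
  qed
  then have "f q * exp (2 * e * q) \<le> f p * exp (2 * e * q)" by simp
  moreover have "exp (- 2 * e * q) * exp (2 * e * q) = 1"
    "exp (- 2 * e * p) * exp (2 * e * q) = exp (2 * e * (q - p))"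
    by (simp_all only: exp_add[symmetric]) (simp_all add: algebra_simps)
  ultimately show ?thesis
    unfolding f_def by (simp only: mult.assoc mult_1_right)
qed

text \<open>
  Off resonance, the solution follows the slowly varying value \<open>-\<i> e a / (\<kappa> - t)\<close> at which the
  right-hand side of the equation for \<open>\<beta>\<close> vanishes; \<open>dev\<close> is the deviation from it.
\<close>

definition "dev t = \<beta> t + \<i> * of_real e * a t / of_real (\<kappa> - t)"

definition "dev2' t = 2 * Re (cnj (dev t) * (a t * (\<i> * of_real e - of_real e ^ 3))) / (\<kappa> - t)\<^sup>2"

text \<open>The deviation solves a linear equation with coefficient \<i> (\<kappa> - t -
  e^2/(\<kappa> - t)) and forcing a (\<i> e - e^3)/(\<kappa> - t)^2. The coefficient is purely
  imaginary, so it leaves |dev|^2 unchanged, and only the forcing, integrable away from \<kappa>, is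
  left in \<open>dev2'\<close>.\<close>

lemma deriv_dev2:
  assumes "0 \<le> p" "q \<le> L" "t \<in> {p..q}" "t \<noteq> \<kappa>"
  shows "((\<lambda>t. (cmod (dev t))\<^sup>2) has_real_derivative dev2' t) (at t within {p..q})"
proof -
  define d where "d = complex_of_real (\<kappa> - t)"
  have d: "d \<noteq> 0" using assms by (simp add: d_def)
  have 1: "((\<lambda>t. of_real (1 / (\<kappa> - t))) has_vector_derivative complex_of_real (1 / (\<kappa> - t)\<^sup>2)) (at t within {p..q})"
    by (rule has_vector_derivative_of_real)
      (use assms in \<open>auto intro!: derivative_eq_intros simp: has_real_derivative_iff_has_vector_derivative[symmetric] power2_eq_square\<close>)
  have "((\<lambda>t. \<beta> t + \<i> * of_real e * (a t * of_real (1 / (\<kappa> - t)))) has_vector_derivative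
      ((\<i> * d * \<beta> t - of_real e * a t) + \<i> * of_real e *
       (a t * of_real (1 / (\<kappa> - t)\<^sup>2) + (- of_real e * \<beta> t) * of_real (1 / (\<kappa> - t))))) (at t within {p..q})"
    unfolding d_def
    by (intro has_vector_derivative_add has_vector_derivative_mult_right has_vector_derivative_mult 1
        deriv_\<beta>_sub deriv_a_sub assms(1-3))
  moreover have "(\<lambda>t. \<beta> t + \<i> * of_real e * (a t * of_real (1 / (\<kappa> - t)))) = dev"
    by (auto simp: dev_def)
  moreover have "((\<i> * d * \<beta> t - of_real e * a t) + \<i> * of_real e *
       (a t * of_real (1 / (\<kappa> - t)\<^sup>2) + (- of_real e * \<beta> t) * of_real (1 / (\<kappa> - t))))
    = \<i> * of_real (\<kappa> - t - e\<^sup>2 / (\<kappa> - t)) * dev t + a t * (\<i> * of_real e - of_real e ^ 3) / of_real ((\<kappa> - t)\<^sup>2)"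
    (is "_ = ?D")
  proof -
    have *: "complex_of_real (1 / (\<kappa> - t)\<^sup>2) = 1 / d^2" "complex_of_real (1 / (\<kappa> - t)) = 1 / d"
      "complex_of_real (\<kappa> - t - e\<^sup>2 / (\<kappa> - t)) = d - (of_real e)\<^sup>2 / d"
      "complex_of_real ((\<kappa> - t)\<^sup>2) = d\<^sup>2"
      by (simp_all add: d_def)
    show ?thesis
      unfolding * dev_def d_def[symmetric] using d
      by (simp add: divide_simps) (simp add: algebra_simps power2_eq_square power3_eq_cube)
  qed
  ultimately have "(dev has_vector_derivative ?D) (at t within {p..q})" by simp
  then have "((\<lambda>t. (cmod (dev t))\<^sup>2) has_real_derivative 2 * Re (cnj (dev t) * ?D)) (at t within {p..q})"
    by (rule has_real_derivative_cmod_power2)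
  moreover have "2 * Re (cnj (dev t) * ?D) = dev2' t"
  proof -
    have "Re (cnj (dev t) * (\<i> * of_real r * dev t)) = 0" for r :: real
      by simp
    moreover have "cnj (dev t) * (a t * (\<i> * of_real e - of_real e ^ 3) / of_real ((\<kappa> - t)\<^sup>2))
      = of_real (1 / (\<kappa> - t)\<^sup>2) * (cnj (dev t) * (a t * (\<i> * of_real e - of_real e ^ 3)))"
      by simp
    moreover have "Re (of_real r * w) = r * Re w" for r w by simp
    ultimately show ?thesis
      unfolding distrib_left dev2'_def plus_complex.sel by simp
  qed
  ultimately show ?thesis by simp
qed

lemma cmod_\<beta>_le_dev:
  assumes "1 \<le> \<bar>\<kappa> - t\<bar>"
  shows "cmod (\<beta> t) \<le> cmod (dev t) + e * cmod (a t) / \<bar>\<kappa> - t\<bar>"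
    and "cmod (dev t) \<le> cmod (\<beta> t) + e * cmod (a t) / \<bar>\<kappa> - t\<bar>"
proof -
  define w where "w = \<i> * of_real e * a t / of_real (\<kappa> - t)"
  have "cmod w = e * cmod (a t) / \<bar>\<kappa> - t\<bar>"
    unfolding w_def norm_divide norm_mult norm_of_real using e_pos by simp
  moreover have "dev t = \<beta> t + w" by (simp add: dev_def w_def)
  ultimately show "cmod (\<beta> t) \<le> cmod (dev t) + e * cmod (a t) / \<bar>\<kappa> - t\<bar>"
    "cmod (dev t) \<le> cmod (\<beta> t) + e * cmod (a t) / \<bar>\<kappa> - t\<bar>"
    using norm_triangle_ineq[of "\<beta> t" w] norm_triangle_ineq4[of "dev t" w] by auto
qed

text \<open>The adiabatic part of \<beta> is at most |a|/16 and is absorbed into the left-hand side;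
  16/15 is 1/(1 - 1/16).\<close>

lemma cmod_a_le_dev:
  assumes "t \<in> {0..L}" "1 \<le> \<bar>\<kappa> - t\<bar>"
  shows "cmod (a t) \<le> 16/15 * (1 + cmod (dev t))"
proof -
  have "e * cmod (a t) / \<bar>\<kappa> - t\<bar> \<le> e * cmod (a t) / 1"
    using assms e_pos by (intro divide_left_mono) auto
  also have "\<dots> \<le> 1/16 * cmod (a t)"
    using mult_right_mono[OF e_le norm_ge_zero[of "a t"]] by simp
  finally have "e * cmod (a t) / \<bar>\<kappa> - t\<bar> \<le> 1/16 * cmod (a t)" .
  moreover have "x \<le> 16/15 * (1 + d)" if "x \<le> 1 + b" "b \<le> d + r" "r \<le> 1/16 * x" for x b d r :: real
    using that by simp
  ultimately show ?thesis
    using cmod_a_le[OF assms(1)] cmod_\<beta>_le_dev(1)[OF assms(2)] by blast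
qed

text \<open>Eliminating \<open>a\<close> closes the inequality in |dev| alone. The computed constant
  is 2 (16/15) (17/16) = 34/15, rounded up to 4.\<close>

lemma abs_dev2'_le:
  assumes "t \<in> {0..L}" "1 \<le> \<bar>\<kappa> - t\<bar>"
  shows "\<bar>dev2' t\<bar> \<le> 4 * e * (cmod (dev t) + (cmod (dev t))\<^sup>2) / (\<kappa> - t)\<^sup>2"
proof -
  define w where "w = \<i> * complex_of_real e - of_real e ^ 3"
  define z where "z = cmod (dev t)"
  have "cmod w \<le> e + e ^ 3"
    unfolding w_def by (rule norm_triangle_ineq4[THEN order_trans]) (use e_pos in \<open>simp add: norm_mult norm_power\<close>)
  also have "e ^ 3 \<le> 1/16 * e"
  proof -
    have "e * e \<le> 1 * (1/16)" using e_pos e_le by (intro mult_mono) auto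
    then have "e * e * e \<le> 1/16 * e" using e_pos by (intro mult_right_mono) auto
    then show ?thesis by (simp add: power3_eq_cube)
  qed
  finally have w: "cmod w \<le> 17/16 * e" by simp
  have "\<bar>2 * Re (cnj (dev t) * (a t * w))\<bar> \<le> 2 * cmod (cnj (dev t) * (a t * w))"
    using abs_Re_le_cmod[of "cnj (dev t) * (a t * w)"] by simp
  also have "\<dots> = 2 * (z * (cmod (a t) * cmod w))" by (simp add: norm_mult z_def)
  also have "\<dots> \<le> 2 * (z * (16/15 * (1 + z) * (17/16 * e)))"
    using w cmod_a_le_dev[OF assms] by (intro mult_left_mono mult_mono) (auto simp: z_def)
  also have "\<dots> = 34/15 * e * (z + z\<^sup>2)" by (simp add: algebra_simps power2_eq_square)
  also have "\<dots> \<le> 4 * e * (z + z\<^sup>2)"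
    using e_pos by (intro mult_right_mono) (auto simp: z_def)
  finally show ?thesis
    unfolding dev2'_def w_def[symmetric] z_def by (simp add: abs_divide divide_right_mono)
qed

lemma dev_0: "\<kappa> \<noteq> 0 \<Longrightarrow> (cmod (dev 0))\<^sup>2 = e\<^sup>2 / \<kappa>\<^sup>2"
  by (simp add: dev_def init_\<beta> init_a norm_divide norm_mult power_divide)

section \<open>Away from the resonance\<close>

text \<open>The deviation starts at size e/\<kappa> and is driven by e/(\<kappa> - u)^2, whose
  integral up to t is of order e/(\<kappa> - t), the size of the adiabatic value itself.\<close>

lemma cmod_\<beta>_before:
  assumes t: "t \<in> {0..L}" and "t + 1 \<le> \<kappa>"
  shows "cmod (\<beta> t) \<le> 5 * e / (\<kappa> - t)"
proof -
  \<comment> \<open>The decreasing weight \<open>\<kappa> - u\<close> contributes -|dev|^2 to the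
    derivative. This absorbs z^2/2 from Young's inequality and z^2/4 from the quadratic term; the
    other Young term, \<open>8 * r\<^sup>2\<close>, is cancelled by the derivative of the subtracted
    fraction.\<close>
  define f where "f u = (cmod (dev u))\<^sup>2 * (\<kappa> - u) - 8 * e\<^sup>2 / (\<kappa> - u)" for u
  define f' where "f' u = dev2' u * (\<kappa> - u) - (cmod (dev u))\<^sup>2 - 8 * e\<^sup>2 / (\<kappa> - u)\<^sup>2" for u
  have "f t \<le> f 0"
  proof (rule has_real_derivative_nonpos_imp_ge[where f = f and f' = f'])
    show "0 \<le> t" using t by simp
    fix u assume u: "u \<in> {0..t}"
    then have "u \<noteq> \<kappa>" and d: "1 \<le> \<kappa> - u" using assms by auto
    have D: "((\<lambda>t. (cmod (dev t))\<^sup>2) has_real_derivative dev2' u) (at u within {0..t})"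
      using t u assms by (intro deriv_dev2) auto
    have "((\<lambda>u. 8 * e\<^sup>2 / (\<kappa> - u)) has_real_derivative 8 * e\<^sup>2 / (\<kappa> - u)\<^sup>2) (at u within {0..t})"
      using \<open>u \<noteq> \<kappa>\<close> by (auto intro!: derivative_eq_intros simp: power2_eq_square)
    moreover have "((\<lambda>u. \<kappa> - u) has_real_derivative -1) (at u within {0..t})"
      by (auto intro!: derivative_eq_intros)
    ultimately have "(f has_real_derivative dev2' u * (\<kappa> - u) + (-1) * (cmod (dev u))\<^sup>2
        - 8 * e\<^sup>2 / (\<kappa> - u)\<^sup>2) (at u within {0..t})"
      unfolding f_def by (intro DERIV_diff DERIV_mult D)
    then show "(f has_real_derivative f' u) (at u within {0..t})" by (simp add: f'_def)
    define z where "z = cmod (dev u)"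
    define r where "r = e / (\<kappa> - u)"
    have r: "0 \<le> r" "r \<le> 1/16"
      using d e_pos e_le frac_le[of "1/16" e 1 "\<kappa> - u"] by (auto simp: r_def)
    have "dev2' u \<le> 4 * e * (z + z\<^sup>2) / (\<kappa> - u)\<^sup>2"
      using abs_dev2'_le[of u] t u d unfolding z_def by auto
    then have "dev2' u * (\<kappa> - u) \<le> 4 * e * (z + z\<^sup>2) / (\<kappa> - u)\<^sup>2 * (\<kappa> - u)"
      using d by (intro mult_right_mono) auto
    also have "\<dots> = 4 * r * z + 4 * r * z\<^sup>2"
      using d by (simp add: r_def field_simps power2_eq_square)
    also have "4 * r * z \<le> z\<^sup>2 / 2 + 8 * r\<^sup>2"
      using zero_le_power2[of "z - 4 * r"] by (simp add: power2_eq_square algebra_simps)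
    also have "4 * r * z\<^sup>2 \<le> 4 * (1/16) * z\<^sup>2"
      using r by (intro mult_right_mono mult_left_mono) auto
    finally show "f' u \<le> 0"
      unfolding f'_def z_def[symmetric]
      by (simp add: r_def power_divide) (use zero_le_power2[of z] in linarith)
  qed
  moreover have "f 0 \<le> 0"
    using assms dev_0 by (simp add: f_def field_simps power2_eq_square)
  ultimately have "(cmod (dev t))\<^sup>2 * (\<kappa> - t) \<le> 8 * e\<^sup>2 / (\<kappa> - t)" by (simp add: f_def)
  then have "(cmod (dev t))\<^sup>2 \<le> 8 * e\<^sup>2 / (\<kappa> - t)\<^sup>2"
    using assms by (simp add: power2_eq_square pos_le_divide_eq flip: divide_divide_eq_left)
  also have "\<dots> \<le> (3 * e / (\<kappa> - t))\<^sup>2" by (simp add: power_divide power_mult_distrib divide_right_mono)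
  finally have z: "cmod (dev t) \<le> 3 * e / (\<kappa> - t)"
    by (rule power2_le_imp_le) (use assms e_pos in auto)
  also have "\<dots> \<le> 3 * (1/16) / 1"
    using e_pos e_le assms by (intro frac_le) auto
  finally have "cmod (a t) \<le> 2" using cmod_a_le_dev[OF t] assms by auto
  then have "e * cmod (a t) / \<bar>\<kappa> - t\<bar> \<le> e * 2 / (\<kappa> - t)"
    using e_pos assms by (simp add: divide_right_mono)
  then show ?thesis
    using cmod_\<beta>_le_dev(1)[of t] assms z by (simp add: add_divide_distrib[symmetric])
qed

text \<open>The resonance lies before time 0, so the system is never resonant: the forcing has total
  mass of order e/|\<kappa>| over all times, and the initial deviation is e/|\<kappa>|. This
  supplies the decay at negative s.\<close>

lemma cmod_\<beta>_left:
  assumes t: "t \<in> {0..L}" and "\<kappa> \<le> -1"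
  shows "cmod (\<beta> t) \<le> 8 * e / \<bar>\<kappa>\<bar>"
proof -
  \<comment> \<open>This is the Young constant: 4 e z \<le> |\<kappa>| z^2 + 4 e^2/|\<kappa>|, whose
    last term is 2 |\<kappa>| c. The exponent of the integrating factor below falls from 2 at u = 0
    but stays nonnegative, so the total loss is at most exp 2.\<close>
  define c where "c = 2 * e\<^sup>2 / \<kappa>\<^sup>2"
  have c: "0 \<le> c" by (simp add: c_def)
  define f where "f u = ((cmod (dev u))\<^sup>2 + c) * exp (2 * \<kappa> / (\<kappa> - u))" for u
  define f' where "f' u = (dev2' u + ((cmod (dev u))\<^sup>2 + c) * (2 * \<kappa> / (\<kappa> - u)\<^sup>2)) * exp (2 * \<kappa> / (\<kappa> - u))" for u
  have "f t \<le> f 0"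
  proof (rule has_real_derivative_nonpos_imp_ge[where f = f and f' = f'])
    show "0 \<le> t" using t by simp
    fix u assume u: "u \<in> {0..t}"
    then have "u \<noteq> \<kappa>" and d: "1 \<le> u - \<kappa>" using assms by auto
    have D: "((\<lambda>t. (cmod (dev t))\<^sup>2) has_real_derivative dev2' u) (at u within {0..t})"
      using t u assms by (intro deriv_dev2) auto
    have "((\<lambda>u. exp (2 * \<kappa> / (\<kappa> - u))) has_real_derivative exp (2 * \<kappa> / (\<kappa> - u)) * (2 * \<kappa> / (\<kappa> - u)\<^sup>2)) (at u within {0..t})"
      using \<open>u \<noteq> \<kappa>\<close> by (auto intro!: derivative_eq_intros simp: power2_eq_square)
    moreover have "((\<lambda>t. (cmod (dev t))\<^sup>2 + c) has_real_derivative dev2' u) (at u within {0..t})"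
      using DERIV_add[OF D DERIV_const[of c]] by simp
    ultimately have "(f has_real_derivative dev2' u * exp (2 * \<kappa> / (\<kappa> - u)) +
        exp (2 * \<kappa> / (\<kappa> - u)) * (2 * \<kappa> / (\<kappa> - u)\<^sup>2) * ((cmod (dev u))\<^sup>2 + c)) (at u within {0..t})"
      unfolding f_def by (intro DERIV_mult)
    then show "(f has_real_derivative f' u) (at u within {0..t})" by (simp only: f'_def ring_distribs mult_ac)
    define z where "z = cmod (dev u)"
    have "4 * e * z \<le> \<bar>\<kappa>\<bar> * z\<^sup>2 + 2 * \<bar>\<kappa>\<bar> * c"
    proof -
      have "2 * \<bar>\<kappa>\<bar> * c = 4 * e\<^sup>2 / \<bar>\<kappa>\<bar>"
        using assms by (simp add: c_def field_simps power2_eq_square)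
      moreover have "0 \<le> (\<bar>\<kappa>\<bar> * z - 2 * e)\<^sup>2 / \<bar>\<kappa>\<bar>" by simp
      moreover have "(\<bar>\<kappa>\<bar> * z - 2 * e)\<^sup>2 / \<bar>\<kappa>\<bar> = \<bar>\<kappa>\<bar> * z\<^sup>2 - 4 * e * z + 4 * e\<^sup>2 / \<bar>\<kappa>\<bar>"
        using assms by (simp add: field_simps power2_eq_square)
      ultimately show ?thesis by linarith
    qed
    moreover have "4 * e * z\<^sup>2 \<le> \<bar>\<kappa>\<bar> * z\<^sup>2"
      using e_le assms by (intro mult_right_mono) auto
    ultimately have "4 * e * (z + z\<^sup>2) \<le> 2 * \<bar>\<kappa>\<bar> * (z\<^sup>2 + c)" by (simp add: algebra_simps)
    then have "4 * e * (z + z\<^sup>2) / (\<kappa> - u)\<^sup>2 \<le> 2 * \<bar>\<kappa>\<bar> * (z\<^sup>2 + c) / (\<kappa> - u)\<^sup>2"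
      by (rule divide_right_mono) simp
    moreover have "dev2' u \<le> 4 * e * (z + z\<^sup>2) / (\<kappa> - u)\<^sup>2"
      using abs_dev2'_le[of u] t u d unfolding z_def by auto
    moreover have "(z\<^sup>2 + c) * (2 * \<kappa> / (\<kappa> - u)\<^sup>2) = - (2 * \<bar>\<kappa>\<bar> * (z\<^sup>2 + c) / (\<kappa> - u)\<^sup>2)"
      using assms by simp
    moreover have "p + q \<le> 0" if "r \<le> s" "p \<le> r" "q = - s" for p q r s :: real
      using that by simp
    ultimately have "dev2' u + (z\<^sup>2 + c) * (2 * \<kappa> / (\<kappa> - u)\<^sup>2) \<le> 0"
      by blast
    then show "f' u \<le> 0"
      unfolding f'_def z_def[symmetric] by (simp add: mult_le_0_iff)
  qed
  moreover have "f 0 = 3 * e\<^sup>2 / \<kappa>\<^sup>2 * exp 2"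
    using assms dev_0 by (simp add: f_def c_def add_divide_distrib[symmetric])
  moreover have "exp (2::real) \<le> 9"
  proof -
    have "exp (2::real) = exp 1 * exp 1" by (simp flip: exp_add)
    also have "\<dots> \<le> 3 * 3" using exp_le by (intro mult_mono) auto
    finally show ?thesis by simp
  qed
  then have "3 * e\<^sup>2 / \<kappa>\<^sup>2 * exp 2 \<le> 3 * e\<^sup>2 / \<kappa>\<^sup>2 * 9"
    by (rule mult_left_mono) simp
  ultimately have "f t \<le> 3 * e\<^sup>2 / \<kappa>\<^sup>2 * 9" by linarith
  moreover have "(cmod (dev t))\<^sup>2 \<le> f t"
  proof -
    have "2 * \<kappa> / (\<kappa> - t) \<ge> 0" using assms by (intro divide_nonpos_nonpos) auto
    then have "1 * (cmod (dev t))\<^sup>2 \<le> exp (2 * \<kappa> / (\<kappa> - t)) * ((cmod (dev t))\<^sup>2 + c)"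
      using c by (intro mult_mono) auto
    then show ?thesis by (simp add: f_def mult.commute)
  qed
  ultimately have "(cmod (dev t))\<^sup>2 \<le> 27 * e\<^sup>2 / \<kappa>\<^sup>2" by simp
  also have "\<dots> \<le> (6 * e / \<bar>\<kappa>\<bar>)\<^sup>2" by (simp add: power_divide power_mult_distrib divide_right_mono)
  finally have z: "cmod (dev t) \<le> 6 * e / \<bar>\<kappa>\<bar>"
    by (rule power2_le_imp_le) (use e_pos in auto)
  also have "\<dots> \<le> 6 * (1/16) / 1"
    using e_pos e_le assms by (intro frac_le) auto
  finally have "cmod (a t) \<le> 2" using cmod_a_le_dev[OF t] assms t by auto
  then have "e * cmod (a t) / \<bar>\<kappa> - t\<bar> \<le> e * 2 / \<bar>\<kappa>\<bar>"
    using e_pos assms t by (intro frac_le mult_left_mono mult_nonneg_nonneg) auto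
  moreover have "1 \<le> \<bar>\<kappa> - t\<bar>" using assms by auto
  ultimately have "cmod (\<beta> t) \<le> 6 * e / \<bar>\<kappa>\<bar> + e * 2 / \<bar>\<kappa>\<bar>"
    using cmod_\<beta>_le_dev(1)[of t] z by linarith
  then show ?thesis by (simp add: add_divide_distrib[symmetric])
qed

text \<open>A lower bound: what the resonance created cannot be undone later. Adding e^2 lets the
  linear part of the forcing be treated as a relative rate 3/(u - \<kappa>)^2, whose integral from
  \<kappa> + R to infinity is 3/R.\<close>

lemma dev_after:
  assumes "0 \<le> \<kappa> + R" "1 \<le> R" "\<kappa> + R \<le> t" "t \<le> L"
  shows "((cmod (dev (\<kappa> + R)))\<^sup>2 + e\<^sup>2) * exp (- 3 / R) \<le> (cmod (dev t))\<^sup>2 + e\<^sup>2"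
proof -
  define f where "f u = ((cmod (dev u))\<^sup>2 + e\<^sup>2) * exp (3 / (\<kappa> - u))" for u
  define f' where "f' u = (dev2' u + ((cmod (dev u))\<^sup>2 + e\<^sup>2) * (3 / (\<kappa> - u)\<^sup>2)) * exp (3 / (\<kappa> - u))" for u
  have "f (\<kappa> + R) \<le> f t"
  proof (rule has_real_derivative_nonneg_imp_le[where f = f and f' = f'])
    show "\<kappa> + R \<le> t" by fact
    fix u assume u: "u \<in> {\<kappa> + R..t}"
    then have "u \<noteq> \<kappa>" and d: "1 \<le> u - \<kappa>" using assms by auto
    have D: "((\<lambda>t. (cmod (dev t))\<^sup>2) has_real_derivative dev2' u) (at u within {\<kappa> + R..t})"
      using u assms by (intro deriv_dev2) auto
    have "((\<lambda>u. exp (3 / (\<kappa> - u))) has_real_derivative exp (3 / (\<kappa> - u)) * (3 / (\<kappa> - u)\<^sup>2)) (at u within {\<kappa> + R..t})"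
      using \<open>u \<noteq> \<kappa>\<close> by (auto intro!: derivative_eq_intros simp: power2_eq_square)
    moreover have "((\<lambda>t. (cmod (dev t))\<^sup>2 + e\<^sup>2) has_real_derivative dev2' u) (at u within {\<kappa> + R..t})"
      using DERIV_add[OF D DERIV_const[of "e\<^sup>2"]] by simp
    ultimately have "(f has_real_derivative dev2' u * exp (3 / (\<kappa> - u)) +
        exp (3 / (\<kappa> - u)) * (3 / (\<kappa> - u)\<^sup>2) * ((cmod (dev u))\<^sup>2 + e\<^sup>2)) (at u within {\<kappa> + R..t})"
      unfolding f_def by (intro DERIV_mult)
    then show "(f has_real_derivative f' u) (at u within {\<kappa> + R..t})" by (simp only: f'_def ring_distribs mult_ac)
    define z where "z = cmod (dev u)"
    have "4 * e * z \<le> 2 * z\<^sup>2 + 2 * e\<^sup>2"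
      using zero_le_power2[of "z - e"] by (simp add: power2_eq_square algebra_simps)
    moreover have "4 * e * z\<^sup>2 \<le> 1 * z\<^sup>2"
      using e_le by (intro mult_right_mono) auto
    ultimately have "4 * e * (z + z\<^sup>2) \<le> 3 * (z\<^sup>2 + e\<^sup>2)"
      by (simp add: algebra_simps) (use zero_le_power2[of e] in linarith)
    then have "4 * e * (z + z\<^sup>2) / (\<kappa> - u)\<^sup>2 \<le> 3 * (z\<^sup>2 + e\<^sup>2) / (\<kappa> - u)\<^sup>2"
      by (rule divide_right_mono) simp
    moreover have "- dev2' u \<le> 4 * e * (z + z\<^sup>2) / (\<kappa> - u)\<^sup>2"
      using abs_dev2'_le[of u] assms u d unfolding z_def by auto
    ultimately have "0 \<le> dev2' u + (z\<^sup>2 + e\<^sup>2) * (3 / (\<kappa> - u)\<^sup>2)"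
      by (simp add: algebra_simps)
    then show "0 \<le> f' u"
      unfolding f'_def z_def[symmetric] by simp
  qed
  also have "f t \<le> ((cmod (dev t))\<^sup>2 + e\<^sup>2) * 1"
    unfolding f_def using assms by (intro mult_left_mono) (auto intro!: divide_nonneg_nonpos)
  finally show ?thesis by (simp add: f_def)
qed

text \<open>
  Across the resonance, \<open>\<beta>\<close> jumps by \<open>e\<close> times a Fresnel integral: the derivative of
  \<open>V\<close> below is of order \<open>e\<^sup>2\<close>.
\<close>

lemma cmod_\<beta>_resonance:
  assumes R: "2 \<le> R" "R \<le> \<kappa>" "\<kappa> + R \<le> L" and small: "e * R \<le> 1/8"
  shows "e * (2/5 - 5 / R - 8 * R\<^sup>2 * e) \<le> cmod (\<beta> (\<kappa> + R))"
proof -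
  define G where "G t = integral {- R..t} (\<lambda>u. cis (u\<^sup>2/2))" for t
  \<comment> \<open>The phase cancels the detuning, so the first summand has derivative -e a times
    the Fresnel integrand. The second summand integrates this by parts: the derivative falls on
    \<open>a\<close>, which brings another factor e.\<close>
  define V where "V t = cis ((t - \<kappa>)\<^sup>2/2) * \<beta> t + of_real e * (a t * G (t - \<kappa>))" for t
  define p q where "p = \<kappa> - R" and "q = \<kappa> + R"
  have pq: "0 \<le> p" "p \<le> q" "q \<le> L" using R by (auto simp: p_def q_def)
  have \<beta>p: "cmod (\<beta> p) \<le> 5 * e / R"
    using cmod_\<beta>_before[of p] R pq by (simp add: p_def)
  have \<beta>p1: "cmod (\<beta> p) \<le> 1"
  proof -
    have "5 * e / R \<le> 5 * (1/16) / 2" using R e_le e_pos by (intro frac_le) auto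
    then show ?thesis using \<beta>p by linarith
  qed
  \<comment> \<open>The crude growth bound is affordable here: the window has length 2 R, and e R is
    small.\<close>
  have \<beta>_le: "cmod (\<beta> t) \<le> 2" if t: "t \<in> {p..q}" for t
  proof -
    have "(cmod (\<beta> t))\<^sup>2 \<le> (cmod (a t))\<^sup>2"
      using cmod_a_power2[of t] t pq by auto
    also have "\<dots> \<le> (cmod (a p))\<^sup>2 * exp (2 * e * (t - p))"
      using t pq by (intro cmod_a_growth) auto
    also have "\<dots> \<le> 2 * 2"
    proof (rule mult_mono)
      show "(cmod (a p))\<^sup>2 \<le> 2"
        using cmod_a_power2[of p] pq power_mono[OF \<beta>p1, of 2] by simp
      have "2 * e * (t - p) \<le> 2 * e * (2 * R)"
        using t e_pos by (intro mult_left_mono) (auto simp: p_def q_def)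
      also have "\<dots> \<le> 1/2" using small by simp
      finally have "exp (2 * e * (t - p)) \<le> exp (1/2)" by simp
      also have "\<dots> \<le> 1 + 1/2 + (1/2)\<^sup>2" by (rule exp_bound) auto
      also have "\<dots> \<le> (2::real)" by (simp add: power2_eq_square)
      finally show "exp (2 * e * (t - p)) \<le> 2" .
    qed auto
    finally have "(cmod (\<beta> t))\<^sup>2 \<le> 2\<^sup>2" by simp
    then show ?thesis by (rule power2_le_imp_le) simp
  qed
  have G': "(G has_vector_derivative cis (u\<^sup>2/2)) (at u within {- R..R})" if "u \<in> {- R..R}" for u
    unfolding G_def by (rule integral_has_vector_derivative[OF _ that]) (auto intro!: continuous_intros)
  have G_le: "cmod (G u) \<le> 2 * R" if "u \<in> {- R..R}" for u
  proof -
    have "cmod (G u) \<le> 1 * (u - (- R))"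
      unfolding G_def using that by (intro integral_bound) (auto intro!: continuous_intros)
    then show ?thesis using that by simp
  qed
  have V': "(V has_vector_derivative of_real e * (- of_real e * \<beta> t * G (t - \<kappa>))) (at t within {p..q})"
    if t: "t \<in> {p..q}" for t
  proof -
    have "((G \<circ> (\<lambda>t. t - \<kappa>)) has_vector_derivative 1 *\<^sub>R cis ((t - \<kappa>)\<^sup>2/2)) (at t within {p..q})"
    proof (rule vector_diff_chain_within)
      have "(\<lambda>t. t - \<kappa>) ` {p..q} = {- R..R}"
        by (auto simp: p_def q_def image_iff Bex_def intro: exI[of _ "_ + \<kappa>"])
      then show "(G has_vector_derivative cis ((t - \<kappa>)\<^sup>2/2)) (at (t - \<kappa>) within (\<lambda>t. t - \<kappa>) ` {p..q})"
        using G'[of "t - \<kappa>"] t by (auto simp: p_def q_def)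
    qed (auto intro!: derivative_eq_intros)
    then have G'': "((\<lambda>t. G (t - \<kappa>)) has_vector_derivative cis ((t - \<kappa>)\<^sup>2/2)) (at t within {p..q})"
      by (simp add: o_def)
    have c': "((\<lambda>t. cis ((t - \<kappa>)\<^sup>2/2)) has_vector_derivative (t - \<kappa>) *\<^sub>R (\<i> * cis ((t - \<kappa>)\<^sup>2/2))) (at t within {p..q})"
      unfolding has_vector_derivative_def
      by (auto intro!: derivative_eq_intros)
    have \<beta>': "(\<beta> has_vector_derivative (\<i> * of_real (\<kappa> - t) * \<beta> t - of_real e * a t)) (at t within {p..q})"
      and a': "(a has_vector_derivative (- of_real e * \<beta> t)) (at t within {p..q})"
      by (rule deriv_\<beta>_sub deriv_a_sub; use pq t in auto)+
    have "(V has_vector_derivative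
        (cis ((t - \<kappa>)\<^sup>2/2) * (\<i> * of_real (\<kappa> - t) * \<beta> t - of_real e * a t)
          + ((t - \<kappa>) *\<^sub>R (\<i> * cis ((t - \<kappa>)\<^sup>2/2))) * \<beta> t)
        + of_real e * (a t * cis ((t - \<kappa>)\<^sup>2/2) + (- of_real e * \<beta> t) * G (t - \<kappa>))) (at t within {p..q})"
      unfolding V_def
      by (intro has_vector_derivative_add has_vector_derivative_mult_right has_vector_derivative_mult \<beta>' a' c' G'')
    then show ?thesis by (simp add: scaleR_conv_of_real algebra_simps)
  qed
  have "cmod (V q - V p) \<le> (e * (e * 2 * (2 * R))) * (q - p)"
  proof (rule norm_diff_le_if_vector_derivative_bounded[OF \<open>p \<le> q\<close> V'])
    fix t assume t: "t \<in> {p..q}"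
    have "cmod (\<beta> t) * cmod (G (t - \<kappa>)) \<le> 2 * (2 * R)"
      using \<beta>_le[OF t] G_le[of "t - \<kappa>"] t by (intro mult_mono) (auto simp: p_def q_def)
    then have "e * (e * (cmod (\<beta> t) * cmod (G (t - \<kappa>)))) \<le> e * (e * (2 * (2 * R)))"
      using e_pos by (intro mult_left_mono) auto
    then show "cmod (of_real e * (- of_real e * \<beta> t * G (t - \<kappa>))) \<le> e * (e * 2 * (2 * R))"
      using e_pos by (simp add: norm_mult mult.assoc)
  qed
  also have "\<dots> = e * (8 * R\<^sup>2 * e)" by (simp add: p_def q_def power2_eq_square)
  finally have 1: "cmod (V q - V p) \<le> e * (8 * R\<^sup>2 * e)" .
  have "G (- R) = 0" by (simp add: G_def)
  then have Vp: "cmod (V p) \<le> 5 * e / R" using \<beta>p by (simp add: V_def p_def norm_mult)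
  \<comment> \<open>As |a| \<ge> 1 by the conservation law, the jump is no smaller than e times the
    Fresnel integral alone.\<close>
  have "e * (1 * (2/5)) \<le> e * (cmod (a q) * cmod (G R))"
    using fresnel_symmetric_lower_bound[OF R(1)] one_le_cmod_a[of q] pq e_pos unfolding G_def
    by (intro mult_left_mono mult_mono) auto
  also have "\<dots> = cmod (of_real e * (a q * G (q - \<kappa>)))"
    using e_pos by (simp add: norm_mult q_def)
  also have "of_real e * (a q * G (q - \<kappa>)) = V q - cis ((q - \<kappa>)\<^sup>2/2) * \<beta> q" by (simp add: V_def)
  also have "cmod (V q - cis ((q - \<kappa>)\<^sup>2/2) * \<beta> q) \<le> cmod (V q) + cmod (\<beta> q)"
    by (rule norm_triangle_ineq4[THEN order_trans]) (simp add: norm_mult)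
  also have "cmod (V q) \<le> cmod (V q - V p) + cmod (V p)"
    using norm_triangle_ineq[of "V q - V p" "V p"] by simp
  finally have "e * (2/5) \<le> e * (8 * R\<^sup>2 * e) + 5 * e / R + cmod (\<beta> q)" using 1 Vp by simp
  then show ?thesis by (simp add: q_def algebra_simps)
qed

text \<open>Here the numbers are spent. Right after the window the factor of e is 2/5 - 5/1000 -
  8/100 = 0.315, used as 3/10. Passing to the deviation leaves 29/100, the later drift leaves 1/4,
  and returning to \<beta> leaves 1/5.\<close>

lemma cmod_\<beta>_after:
  assumes e: "e = 1/10^8" and R: "R = 1000" and "R \<le> \<kappa>" "\<kappa> + R \<le> t" "t \<le> L"
  shows "e / 5 \<le> cmod (\<beta> t)"
proof -
  have t: "t \<in> {0..L}" "\<kappa> + R \<in> {0..L}" using assms by auto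
  have e_mult: "e * x = x / 10^8" for x
    by (simp add: e)
  define q where "q = \<kappa> + R"
  have q: "q \<in> {0..L}" "\<kappa> - q = - R" "1 \<le> \<bar>\<kappa> - q\<bar>" using t R by (auto simp: q_def)
  have "e * (2/5 - 5 / R - 8 * R\<^sup>2 * e) \<le> cmod (\<beta> q)"
    unfolding q_def using assms by (intro cmod_\<beta>_resonance) auto
  then have 1: "e * (3/10) \<le> cmod (\<beta> q)" by (simp add: R e)
  have "cmod (\<beta> q) \<le> cmod (dev q) + e * cmod (a q) / 1000"
    using cmod_\<beta>_le_dev(1)[OF q(3)] q(2) R by simp
  moreover have "cmod (a q) \<le> 16/15 * (1 + cmod (dev q))"
    by (rule cmod_a_le_dev) (use q in auto)
  ultimately have "e * (29/100) \<le> cmod (dev q)" using 1 unfolding e_mult by simp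
  then have "(e * (29/100))\<^sup>2 \<le> (cmod (dev q))\<^sup>2" using e_pos by (intro power_mono) auto
  moreover have "((cmod (dev q))\<^sup>2 + e\<^sup>2) * exp (- 3 / R) \<le> (cmod (dev t))\<^sup>2 + e\<^sup>2"
    unfolding q_def using assms by (intro dev_after) auto
  moreover have "((cmod (dev q))\<^sup>2 + e\<^sup>2) * (1 - 3/1000) \<le> ((cmod (dev q))\<^sup>2 + e\<^sup>2) * exp (- 3 / R)"
    using exp_ge_add_one_self[of "- 3 / R"] R by (intro mult_left_mono) auto
  \<comment> \<open>With \<open>E\<close> standing for e^2, the claim is that (1 + 0.29^2) (1 -
    0.003) - 1 exceeds 1/16.\<close>
  moreover have "E * (1/4)\<^sup>2 \<le> Y"
    if "0 \<le> E" "E * (29/100)\<^sup>2 \<le> X" "(X + E) * k \<le> Y + E" "(X + E) * (1 - 3/1000) \<le> (X + E) * k" for E X Y k :: real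
    using that by (simp add: power2_eq_square)
  ultimately have "(e * (1/4))\<^sup>2 \<le> (cmod (dev t))\<^sup>2"
    unfolding power_mult_distrib using zero_le_power2[of e] by blast
  then have 2: "e * (1/4) \<le> cmod (dev t)" by (rule power2_le_imp_le) simp
  have "cmod (dev t) \<le> cmod (\<beta> t) + e * cmod (a t) / \<bar>\<kappa> - t\<bar>"
    by (rule cmod_\<beta>_le_dev) (use assms in auto)
  also have "e * cmod (a t) / \<bar>\<kappa> - t\<bar> \<le> e * (1 + cmod (\<beta> t)) / 1000"
    using cmod_a_le[OF t(1)] assms e_pos by (intro frac_le mult_left_mono) auto
  finally have "cmod (dev t) \<le> cmod (\<beta> t) + e * (1 + cmod (\<beta> t)) / 1000" by simp
  moreover have "e / 5 \<le> b" if "d \<le> b + e * (1 + b) / 1000" "e * (1/4) \<le> d" for b d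
    using that by (simp add: e field_simps)
  ultimately show ?thesis using 2 by blast
qed

end

section \<open>Dependence on the spectral parameter\<close>

text \<open>\<open>krein_X\<close> selects a solution separately for each k, so regularity in k has
  to come from an estimate valid for any two solutions. The exponential constant is harmless, as
  only continuity is drawn from it.\<close>

lemma landau_zener_lipschitz_in_detuning:
  assumes "landau_zener e \<kappa> L \<beta> a" "landau_zener e \<kappa>' L \<beta>' a'" and t: "t \<in> {0..L}"
  shows "cmod (a t - a' t) \<le> \<bar>\<kappa> - \<kappa>'\<bar> * exp (2 * L)"
proof -
  interpret A: landau_zener e \<kappa> L \<beta> a by fact
  interpret A': landau_zener e \<kappa>' L \<beta>' a' by fact
  \<comment> \<open>Bounds the squared inhomogeneity: |\<beta>'| \<le> |a'| \<le> exp L. Included in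
    the energy, it makes the Gronwall inequality homogeneous, with rate 2.\<close>
  define M where "M = ((\<kappa> - \<kappa>') * exp L)\<^sup>2"
  define p where "p u = \<beta> u - \<beta>' u" for u
  define q where "q u = a u - a' u" for u
  define f where "f u = ((cmod (p u))\<^sup>2 + (cmod (q u))\<^sup>2 + M) * exp (- 2 * u)" for u
  define p' where "p' u = \<i> * of_real (\<kappa> - u) * p u - of_real e * q u + \<i> * of_real (\<kappa> - \<kappa>') * \<beta>' u" for u
  define q' where "q' u = - of_real e * p u" for u
  define h where "h u = 2 * Re (cnj (p u) * p' u) + 2 * Re (cnj (q u) * q' u)" for u
  define f' where "f' u = (h u - 2 * ((cmod (p u))\<^sup>2 + (cmod (q u))\<^sup>2 + M)) * exp (- 2 * u)" for u
  have "f t \<le> f 0"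
  proof (rule has_real_derivative_nonpos_imp_ge[where f = f and f' = f'])
    show "0 \<le> t" using t by simp
    fix u assume u: "u \<in> {0..t}"
    then have u': "u \<in> {0..L}" using t by auto
    have "(p has_vector_derivative (\<i> * of_real (\<kappa> - u) * \<beta> u - of_real e * a u) -
        (\<i> * of_real (\<kappa>' - u) * \<beta>' u - of_real e * a' u)) (at u within {0..t})"
      unfolding p_def by (intro has_vector_derivative_diff A.deriv_\<beta>_sub A'.deriv_\<beta>_sub) (use t u in auto)
    then have p: "(p has_vector_derivative p' u) (at u within {0..t})"
      unfolding p'_def p_def q_def by (simp add: algebra_simps)
    have "(q has_vector_derivative (- of_real e * \<beta> u) - (- of_real e * \<beta>' u)) (at u within {0..t})"
      unfolding q_def by (intro has_vector_derivative_diff A.deriv_a_sub A'.deriv_a_sub) (use t u in auto)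
    then have q: "(q has_vector_derivative q' u) (at u within {0..t})"
      unfolding p_def q'_def by (simp add: algebra_simps)
    have "((\<lambda>u. exp (- 2 * u)) has_real_derivative exp (- 2 * u) * (- 2)) (at u within {0..t})"
      by (auto intro!: derivative_eq_intros)
    moreover have "((\<lambda>u. (cmod (p u))\<^sup>2 + (cmod (q u))\<^sup>2 + M) has_real_derivative h u + 0) (at u within {0..t})"
      unfolding h_def
      by (intro DERIV_add[OF DERIV_add[OF has_real_derivative_cmod_power2[OF p] has_real_derivative_cmod_power2[OF q]] DERIV_const])
    ultimately have "(f has_real_derivative (h u + 0) * exp (- 2 * u) +
        exp (- 2 * u) * (- 2) * ((cmod (p u))\<^sup>2 + (cmod (q u))\<^sup>2 + M)) (at u within {0..t})"
      unfolding f_def by (intro DERIV_mult)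
    then show "(f has_real_derivative f' u) (at u within {0..t})"
      by (simp add: f'_def algebra_simps)
    have "h u = - 4 * e * Re (cnj (p u) * q u) + 2 * ((\<kappa> - \<kappa>') * Re (cnj (p u) * (\<i> * \<beta>' u)))"
      unfolding h_def p'_def q'_def by (simp add: algebra_simps)
    also have "\<dots> \<le> 4 * e * (cmod (p u) * cmod (q u)) + 2 * (\<bar>\<kappa> - \<kappa>'\<bar> * (cmod (p u) * cmod (\<beta>' u)))"
    proof (rule add_mono)
      have "- Re (cnj (p u) * q u) \<le> cmod (p u) * cmod (q u)"
        using abs_Re_le_cmod[of "cnj (p u) * q u"] by (simp add: norm_mult)
      then have "4 * e * (- Re (cnj (p u) * q u)) \<le> 4 * e * (cmod (p u) * cmod (q u))"
        using A.e_pos by (intro mult_left_mono) auto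
      then show "- 4 * e * Re (cnj (p u) * q u) \<le> 4 * e * (cmod (p u) * cmod (q u))"
        by (simp only: mult_minus_left mult_minus_right)
      have "\<bar>\<kappa> - \<kappa>'\<bar> * \<bar>Re (cnj (p u) * (\<i> * \<beta>' u))\<bar> \<le> \<bar>\<kappa> - \<kappa>'\<bar> * (cmod (p u) * cmod (\<beta>' u))"
        using abs_Re_le_cmod[of "cnj (p u) * (\<i> * \<beta>' u)"] by (intro mult_left_mono) (auto simp: norm_mult)
      then show "2 * ((\<kappa> - \<kappa>') * Re (cnj (p u) * (\<i> * \<beta>' u))) \<le> 2 * (\<bar>\<kappa> - \<kappa>'\<bar> * (cmod (p u) * cmod (\<beta>' u)))"
        using abs_ge_self[of "(\<kappa> - \<kappa>') * Re (cnj (p u) * (\<i> * \<beta>' u))"]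
        unfolding abs_mult by linarith
    qed
    also have "4 * e * (cmod (p u) * cmod (q u)) \<le> 2 * e * ((cmod (p u))\<^sup>2 + (cmod (q u))\<^sup>2)"
      using mult_left_mono[OF sum_squares_bound[of "cmod (p u)" "cmod (q u)"], of "2 * e"] A.e_pos
      by (simp add: algebra_simps)
    also have "\<dots> \<le> 1 * ((cmod (p u))\<^sup>2 + (cmod (q u))\<^sup>2)"
      using A.e_le by (intro mult_right_mono) auto
    also have "2 * (\<bar>\<kappa> - \<kappa>'\<bar> * (cmod (p u) * cmod (\<beta>' u))) \<le> (\<bar>\<kappa> - \<kappa>'\<bar> * cmod (\<beta>' u))\<^sup>2 + (cmod (p u))\<^sup>2"
      using sum_squares_bound[of "\<bar>\<kappa> - \<kappa>'\<bar> * cmod (\<beta>' u)" "cmod (p u)"] by (simp add: algebra_simps)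
    also have "(\<bar>\<kappa> - \<kappa>'\<bar> * cmod (\<beta>' u))\<^sup>2 \<le> M"
    proof -
      have "(cmod (\<beta>' u))\<^sup>2 \<le> (cmod (a' u))\<^sup>2"
        using A'.cmod_a_power2[OF u'] by simp
      also have "\<dots> \<le> 1 * exp (2 * e * (u - 0))"
        using A'.cmod_a_growth[of 0 u] u' A'.init_a by simp
      also have "2 * e * (u - 0) \<le> 2 * 1 * L"
        using A.e_pos A.e_le u' by (intro mult_mono) auto
      finally have "(cmod (\<beta>' u))\<^sup>2 \<le> (exp L)\<^sup>2"
        by (simp add: power2_eq_square flip: exp_add)
      then show ?thesis unfolding M_def power_mult_distrib power2_abs by (intro mult_left_mono) auto
    qed
    finally have "h u \<le> 1 * ((cmod (p u))\<^sup>2 + (cmod (q u))\<^sup>2) + (M + (cmod (p u))\<^sup>2)" by simp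
    moreover have "0 \<le> M" by (simp add: M_def)
    moreover have "x - 2 * (y + z + m) \<le> 0" if "x \<le> 1 * (y + z) + (m + y)" "0 \<le> m" "0 \<le> z" for x y z m :: real
      using that by simp
    ultimately have "h u - 2 * ((cmod (p u))\<^sup>2 + (cmod (q u))\<^sup>2 + M) \<le> 0"
      using zero_le_power2 by blast
    then show "f' u \<le> 0" unfolding f'_def by (simp add: mult_le_0_iff)
  qed
  moreover have "f 0 = M"
    by (simp add: f_def p_def q_def A.init_\<beta> A.init_a A'.init_\<beta> A'.init_a)
  ultimately have "((cmod (p t))\<^sup>2 + (cmod (q t))\<^sup>2 + M) * exp (- 2 * t) \<le> M" by (simp add: f_def)
  then have "((cmod (p t))\<^sup>2 + (cmod (q t))\<^sup>2 + M) * exp (- 2 * t) * exp (2 * t) \<le> M * exp (2 * t)"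
    by (rule mult_right_mono) simp
  then have "(cmod (p t))\<^sup>2 + (cmod (q t))\<^sup>2 + M \<le> M * exp (2 * t)"
    by (simp add: mult.assoc flip: exp_add)
  moreover have "M * exp (2 * t) \<le> M * exp (2 * L)"
    using t by (intro mult_left_mono) (auto simp: M_def)
  moreover have "M * exp (2 * L) = (\<bar>\<kappa> - \<kappa>'\<bar> * exp (2 * L))\<^sup>2"
    unfolding M_def power_mult_distrib power2_abs exp_double by (simp add: power2_eq_square)
  moreover have "z \<le> w" if "y + z + m \<le> r" "r \<le> r'" "r' = w" "0 \<le> m" "0 \<le> y" for y z m r r' w :: real
    using that by simp
  moreover have "0 \<le> M" by (simp add: M_def)
  ultimately have "(cmod (q t))\<^sup>2 \<le> (\<bar>\<kappa> - \<kappa>'\<bar> * exp (2 * L))\<^sup>2"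
    using zero_le_power2 by blast
  then show ?thesis unfolding q_def by (rule power2_le_imp_le) simp
qed

subsection \<open>Solutions of the Krein system\<close>

text \<open>Picard iteration in a weighted sup norm. Writing X as exp (2 B t) times a bounded
  function y makes the integral operator a contraction by 1/2 on the whole half-line at once, so no
  local solutions have to be glued.\<close>

lemma lipschitz_integral_equation_solvable:
  fixes F :: "real \<Rightarrow> 'a::euclidean_space \<Rightarrow> 'a"
  assumes B: "0 < B"
    and lip: "\<And>t u v. norm (F t u - F t v) \<le> B * norm (u - v)"
    and zero: "\<And>t. F t 0 = 0"
    and meas: "\<And>f. continuous_on UNIV f \<Longrightarrow> (\<lambda>t. F t (f t)) \<in> borel_measurable lebesgue"
  shows "\<exists>X. continuous_on {0..} X \<and>
    (\<forall>x\<ge>0. set_integrable lebesgue {0..x} (\<lambda>t. F t (X t)) \<and>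
            X x = v + (LINT t:{0..x}|lebesgue. F t (X t)))"
proof -
  \<comment> \<open>The cut-off \<open>max 0 t\<close> extends the weight to negative times, because
    \<open>bcontfun\<close> lives on all of the reals.\<close>
  define E where "E t = exp (2 * B * max 0 t)" for t
  have E_cont: "continuous_on UNIV E"
    unfolding E_def by (intro continuous_intros)
  have E_pos: "0 < E t" for t by (simp add: E_def)
  define J where "J y x = (LINT t:{0..x}|lebesgue. F t (E t *\<^sub>R apply_bcontfun y t))"
    for y :: "real \<Rightarrow>\<^sub>C 'a" and x
  define T where "T y x = (1 / E x) *\<^sub>R (v + J y (max 0 x))" for y :: "real \<Rightarrow>\<^sub>C 'a" and x
  have F_le: "norm (F t u) \<le> B * norm u" for t u
    using lip[of t u 0] by (simp add: zero)
  have int: "set_integrable lebesgue {0..x} (\<lambda>t. F t (E t *\<^sub>R apply_bcontfun y t))" for y x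
  proof -
    obtain N where N: "norm (apply_bcontfun y t) \<le> N" for t
      using bounded_apply_bcontfun[of y] unfolding bounded_iff by auto
    have "norm (F t (E t *\<^sub>R apply_bcontfun y t)) \<le> B * (E x * N)" if "t \<in> {0..x}" for t
    proof -
      have "norm (F t (E t *\<^sub>R apply_bcontfun y t)) \<le> B * (E t * norm (apply_bcontfun y t))"
        using F_le[of t "E t *\<^sub>R apply_bcontfun y t"] E_pos[of t] by simp
      also have "\<dots> \<le> B * (E x * N)"
        using that B N[of t] E_pos by (intro mult_left_mono mult_mono) (auto simp: E_def)
      finally show ?thesis .
    qed
    moreover have "(\<lambda>t. F t (E t *\<^sub>R apply_bcontfun y t)) \<in> borel_measurable lebesgue"
      by (intro meas continuous_intros E_cont continuous_on_apply_bcontfun)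
    ultimately show ?thesis
      unfolding set_integrable_def
      by (intro integrableI_bounded_set_indicator[where B = "B * (E x * N)"]) (auto simp: emeasure_lborel_Icc_eq)
  qed
  have diff: "norm (J y x - J z x) \<le> D * (E x - 1) / 2"
    if x: "0 \<le> x" and D: "\<And>t. norm (apply_bcontfun y t - apply_bcontfun z t) \<le> D" for x y z D
  proof -
    have D0: "0 \<le> D" using D[of 0] norm_ge_zero order_trans by blast
    \<comment> \<open>The weight grows at twice the Lipschitz rate; integrating it yields the
      division by 2, hence the contraction constant.\<close>
    have g: "((\<lambda>t. B * D * exp (2 * B * t)) has_integral (D * exp (2 * B * x) / 2 - D * exp (2 * B * 0) / 2)) {0..x}"
      by (rule fundamental_theorem_of_calculus[OF x])
        (use B in \<open>auto intro!: derivative_eq_intros simp: has_real_derivative_iff_has_vector_derivative[symmetric]\<close>)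
    let ?f = "\<lambda>t. F t (E t *\<^sub>R apply_bcontfun y t) - F t (E t *\<^sub>R apply_bcontfun z t)"
    have f: "set_integrable lebesgue {0..x} ?f"
      by (intro set_integral_diff int)
    have "J y x - J z x = (LINT t:{0..x}|lebesgue. ?f t)"
      unfolding J_def by (rule set_integral_diff(2)[symmetric]; rule int)
    also have "\<dots> = integral {0..x} ?f"
      by (rule set_lebesgue_integral_eq_integral[OF f])
    also have "norm \<dots> \<le> integral {0..x} (\<lambda>t. B * D * exp (2 * B * t))"
    proof (rule integral_norm_bound_integral)
      show "?f integrable_on {0..x}" by (rule set_lebesgue_integral_eq_integral[OF f])
      show "(\<lambda>t. B * D * exp (2 * B * t)) integrable_on {0..x}" using g by blast
      fix t assume t: "t \<in> {0..x}"
      have "norm (?f t) \<le> B * (E t * norm (apply_bcontfun y t - apply_bcontfun z t))"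
        using lip[of t "E t *\<^sub>R apply_bcontfun y t" "E t *\<^sub>R apply_bcontfun z t"] E_pos[of t]
        by (simp add: scaleR_diff_right[symmetric])
      also have "\<dots> \<le> B * (E t * D)"
        using B D E_pos[of t] by (intro mult_left_mono) auto
      finally show "norm (?f t) \<le> B * D * exp (2 * B * t)"
        using t by (simp add: E_def ac_simps)
    qed
    also have "\<dots> = D * (E x - 1) / 2"
      unfolding integral_unique[OF g] using x by (simp add: E_def diff_divide_distrib right_diff_distrib)
    finally show ?thesis .
  qed
  have J_cont: "continuous_on {0..} (J y)" for y
  proof (rule continuous_on_eq_continuous_within[THEN iffD2], rule ballI)
    fix x :: real assume x: "x \<in> {0..}"
    have "continuous_on {0..x+1} (\<lambda>u. integral {0..u} (\<lambda>t. F t (E t *\<^sub>R apply_bcontfun y t)))"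
      by (intro indefinite_integral_continuous_1 set_lebesgue_integral_eq_integral int)
    then have "continuous_on {0..x+1} (J y)"
      unfolding J_def by (simp add: set_lebesgue_integral_eq_integral[OF int])
    then have "continuous (at x within {0..x+1}) (J y)"
      using x by (simp add: continuous_on_eq_continuous_within)
    moreover have "at x within {0..x+1} = at x within {0..}"
      by (rule at_within_nhd[of x "{..<x+1}"]) auto
    ultimately show "continuous (at x within {0..}) (J y)" by simp
  qed
  have T_bcontfun: "T y \<in> bcontfun" for y
  proof -
    have "continuous_on UNIV (\<lambda>x. J y (max 0 x))"
      by (rule continuous_on_compose2[OF J_cont]) (auto intro!: continuous_intros)
    then have "continuous_on UNIV (T y)"
      unfolding T_def using E_pos by (intro continuous_intros E_cont) (auto simp: less_imp_neq[symmetric])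
    moreover have "bounded (range (T y))"
    proof -
      obtain N where N: "norm (apply_bcontfun y t) \<le> N" for t
        using bounded_apply_bcontfun[of y] unfolding bounded_iff by auto
      have N0: "0 \<le> N" using N[of 0] norm_ge_zero order_trans by blast
      have "norm (T y x) \<le> norm v + N" for x
      proof -
        have "J 0 u = 0" for u by (simp add: J_def zero)
        \<comment> \<open>Boundedness of \<open>T y\<close> is the contraction estimate against z =
          0, where \<open>J\<close> vanishes.\<close>
        then have "norm (J y (max 0 x)) \<le> N * (E (max 0 x) - 1) / 2"
          using diff[of "max 0 x" y 0 N] N by simp
        also have "\<dots> \<le> E x * N"
          using N0 E_pos[of x] by (simp add: E_def algebra_simps add_increasing)
        finally have J: "norm (J y (max 0 x)) \<le> E x * N" .
        have "1 * norm v \<le> E x * norm v" using B by (intro mult_right_mono) (auto simp: E_def)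
        then have "norm (v + J y (max 0 x)) \<le> E x * norm v + E x * N"
          using J norm_triangle_ineq[of v "J y (max 0 x)"] by linarith
        then show ?thesis
          using E_pos[of x] by (simp add: T_def pos_divide_le_eq distrib_left mult.commute)
      qed
      then show ?thesis unfolding bounded_iff by blast
    qed
    ultimately show ?thesis by (simp add: bcontfun_def)
  qed
  have "\<exists>!y. Bcontfun (T y) = y"
  proof (rule banach_fix_type[where c = "1/2"])
    show "\<forall>y z. dist (Bcontfun (T y)) (Bcontfun (T z)) \<le> 1/2 * dist y z"
    proof (intro allI dist_bound)
      fix y z :: "real \<Rightarrow>\<^sub>C 'a" and x
      have "dist (Bcontfun (T y) x) (Bcontfun (T z) x) = norm (T y x - T z x)"
        using T_bcontfun by (simp add: Bcontfun_inverse dist_norm)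
      also have "\<dots> = norm (J y (max 0 x) - J z (max 0 x)) / E x"
        using E_pos[of x] by (simp add: T_def scaleR_diff_right[symmetric])
      also have "\<dots> \<le> (dist y z * (E x - 1) / 2) / E x"
        using diff[of "max 0 x" y z "dist y z"] dist_bounded[of y _ z] E_pos[of x]
        by (intro divide_right_mono) (auto simp: dist_norm E_def)
      also have "\<dots> \<le> 1/2 * dist y z"
        using E_pos[of x] by (simp add: divide_simps mult_left_mono)
      finally show "dist (Bcontfun (T y) x) (Bcontfun (T z) x) \<le> 1/2 * dist y z" .
    qed
  qed auto
  then obtain y where y: "Bcontfun (T y) = y" by blast
  then have y': "apply_bcontfun y x = T y x" for x
    using T_bcontfun Bcontfun_inverse by metis
  define X where "X x = E x *\<^sub>R apply_bcontfun y x" for x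
  have "continuous_on {0..} X"
    unfolding X_def by (intro continuous_intros continuous_on_subset[OF E_cont]) auto
  moreover have "X x = v + (LINT t:{0..x}|lebesgue. F t (X t))" if "0 \<le> x" for x
    using that E_pos[of x] unfolding X_def y'[of x] by (simp add: T_def J_def)
  moreover have "set_integrable lebesgue {0..x} (\<lambda>t. F t (X t))" for x
    using int unfolding X_def .
  ultimately show ?thesis by blast
qed

lemma krein_matrix_mult_nth [simp]:
  "(krein_matrix A k t ** Y) $ 1 $ j = \<i> * k * Y $ 1 $ j - cnj (A t) * Y $ 2 $ j"
  "(krein_matrix A k t ** Y) $ 2 $ j = - A t * Y $ 1 $ j"
  by (simp_all add: krein_matrix_def matrix_matrix_mult_def sum_2)

lemma norm_krein_matrix_mult_le:
  fixes Y :: "complex^2^2"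
  assumes "cmod (A t) \<le> m"
  shows "norm (krein_matrix A k t ** Y) \<le> 4 * (cmod k + m) * norm Y"
proof -
  have entry: "cmod (Z $ i $ j) \<le> norm Z" for Z :: "complex^2^2" and i j
    using Finite_Cartesian_Product.norm_nth_le[of "Z $ i" j]
      Finite_Cartesian_Product.norm_nth_le[of Z i] by linarith
  have m: "0 \<le> m" using assms norm_ge_zero order_trans by blast
  let ?Z = "krein_matrix A k t ** Y"
  have 1: "cmod (?Z $ 1 $ j) \<le> (cmod k + m) * norm Y" for j
  proof -
    have "cmod (?Z $ 1 $ j) \<le> cmod k * cmod (Y $ 1 $ j) + cmod (A t) * cmod (Y $ 2 $ j)"
      by (simp add: norm_triangle_ineq4[THEN order_trans] norm_mult)
    also have "\<dots> \<le> cmod k * norm Y + m * norm Y"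
      using assms m by (intro add_mono mult_mono) (auto simp: entry)
    finally show ?thesis by (simp add: distrib_right)
  qed
  have 2: "cmod (?Z $ 2 $ j) \<le> (cmod k + m) * norm Y" for j
  proof -
    have "cmod (?Z $ 2 $ j) \<le> (cmod k + m) * norm Y"
      unfolding krein_matrix_mult_nth norm_mult norm_minus_cancel
      using assms m by (intro mult_mono) (auto simp: add_increasing entry)
    then show ?thesis .
  qed
  have "norm Z \<le> norm (Z $ 1) + norm (Z $ 2)" for Z :: "'a::real_normed_vector ^ 2"
    using L2_set_le_sum[of UNIV "\<lambda>i. norm (Z $ i)"] by (simp add: norm_vec_def sum_2)
  then have "norm ?Z \<le> norm (?Z $ 1) + norm (?Z $ 2)"
    and "norm (?Z $ 1) \<le> cmod (?Z $ 1 $ 1) + cmod (?Z $ 1 $ 2)"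
    and "norm (?Z $ 2) \<le> cmod (?Z $ 2 $ 1) + cmod (?Z $ 2 $ 2)" by blast+
  then show ?thesis using 1[of 1] 1[of 2] 2[of 1] 2[of 2]
    by (simp only: mult.assoc)
qed

lemma continuous_on_krein_matrix:
  assumes "continuous_on S A"
  shows "continuous_on S (krein_matrix A k)"
proof -
  have "continuous_on S (\<lambda>t. \<chi> i j. krein_matrix A k t $ i $ j)"
  proof (intro continuous_on_vec_lambda)
    fix i j :: 2
    show "continuous_on S (\<lambda>t. krein_matrix A k t $ i $ j)"
      using exhaust_2[of i] exhaust_2[of j]
      by (elim disjE; simp add: krein_matrix_def; intro continuous_intros assms)
  qed
  then show ?thesis by (simp add: vec_nth_inverse)
qed

lemma continuous_on_matrix_mult:
  fixes f g :: "'a::topological_space \<Rightarrow> complex^2^2"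
  assumes "continuous_on S f" "continuous_on S g"
  shows "continuous_on S (\<lambda>x. f x ** g x)"
  unfolding matrix_matrix_mult_def
  by (intro continuous_intros continuous_on_vec_lambda assms)

text \<open>Existence gives the \<open>SOME\<close> in \<open>krein_X\<close> a meaning. The
  coefficient may jump at \<open>L\<close>, so measurability is checked on the two pieces
  separately.\<close>

lemma krein_solution_exists:
  assumes cont: "continuous_on UNIV c" and bound: "\<And>t. t \<in> {0..L} \<Longrightarrow> cmod (c t) \<le> m"
  shows "\<exists>X. krein_solution (\<lambda>t. if t \<in> {0..L} then c t else 0) k X"
proof -
  define A where "A t = (if t \<in> {0..L} then c t else 0)" for t
  have A: "cmod (A t) \<le> max m 0" for t using bound[of t] by (auto simp: A_def)
  define B where "B = 4 * (cmod k + max m 0) + 1"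
  have "\<exists>X :: real \<Rightarrow> complex^2^2. continuous_on {0..} X \<and>
    (\<forall>x\<ge>0. set_integrable lebesgue {0..x} (\<lambda>t. krein_matrix A k t ** X t) \<and>
            X x = mat 1 + (LINT t:{0..x}|lebesgue. krein_matrix A k t ** X t))"
  proof (rule lipschitz_integral_equation_solvable)
    show "0 < B" by (simp add: B_def add_nonneg_pos)
    fix t and u v :: "complex^2^2"
    have "norm (krein_matrix A k t ** (u - v)) \<le> B * norm (u - v)"
      using norm_krein_matrix_mult_le[where A = A and t = t and m = "max m 0" and k = k and Y = "u - v", OF A] unfolding B_def
      by (simp add: distrib_right add_increasing2)
    moreover have "krein_matrix A k t ** (u - v) = krein_matrix A k t ** u - krein_matrix A k t ** v"
      by (simp add: matrix_matrix_mult_def vec_eq_iff sum_subtractf right_diff_distrib)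
    ultimately show "norm (krein_matrix A k t ** u - krein_matrix A k t ** v) \<le> B * norm (u - v)"
      by simp
  next
    fix f :: "real \<Rightarrow> complex^2^2" assume f: "continuous_on UNIV f"
    have "(\<lambda>t. if t \<in> {0..L} then krein_matrix c k t ** f t else krein_matrix (\<lambda>_. 0) k t ** f t)
        \<in> borel_measurable lebesgue"
    proof (rule measurable_If_set)
      have "(\<lambda>t. krein_matrix d k t ** f t) \<in> borel_measurable lebesgue" if "continuous_on UNIV d" for d
        by (intro measurable_completion)
          (auto intro!: borel_measurable_continuous_onI continuous_on_matrix_mult continuous_on_krein_matrix f that)
      then show "(\<lambda>t. krein_matrix c k t ** f t) \<in> borel_measurable lebesgue"
        "(\<lambda>t. krein_matrix (\<lambda>_. 0) k t ** f t) \<in> borel_measurable lebesgue"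
        using cont by auto
    qed simp
    moreover have "(if t \<in> {0..L} then krein_matrix c k t ** f t else krein_matrix (\<lambda>_. 0) k t ** f t)
        = krein_matrix A k t ** f t" for t
      by (auto simp: krein_matrix_def A_def)
    ultimately show "(\<lambda>t. krein_matrix A k t ** f t) \<in> borel_measurable lebesgue" by simp
  qed simp
  then show ?thesis unfolding krein_solution_def A_def by blast
qed

text \<open>Where the coefficient is continuous the integrated equation is a classical one.
  Differentiating within [0, L] hides a jump of the coefficient at L.\<close>

lemma krein_solution_has_vector_derivative:
  assumes X: "krein_solution A k X" and A: "continuous_on {0..L} A" and t: "t \<in> {0..L}"
  shows "(X has_vector_derivative (krein_matrix A k t ** X t)) (at t within {0..L})"
proof -
  let ?F = "\<lambda>t. krein_matrix A k t ** X t"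
  have "continuous_on {0..L} X"
    using X by (auto simp: krein_solution_def intro: continuous_on_subset)
  then have "continuous_on {0..L} ?F"
    by (intro continuous_on_matrix_mult continuous_on_krein_matrix A)
  then have "((\<lambda>x. integral {0..x} ?F) has_vector_derivative ?F t) (at t within {0..L})"
    by (rule integral_has_vector_derivative[OF _ t])
  then have "((\<lambda>x. mat 1 + integral {0..x} ?F) has_vector_derivative 0 + ?F t) (at t within {0..L})"
    by (intro has_vector_derivative_add has_vector_derivative_const)
  then have D: "((\<lambda>x. mat 1 + integral {0..x} ?F) has_vector_derivative ?F t) (at t within {0..L})" by simp
  have eq: "X x = mat 1 + integral {0..x} ?F" if "x \<in> {0..L}" for x
    using X that unfolding krein_solution_def
    by (auto simp flip: set_lebesgue_integral_eq_integral(2))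
  show ?thesis
    by (rule has_vector_derivative_transform[OF t _ D]) (use eq in auto)
qed

lemma krein_solution_0:
  assumes "krein_solution A k X"
  shows "X 0 = mat 1"
  using assms set_lebesgue_integral_eq_integral(2)[of "{0..0}" "\<lambda>t. krein_matrix A k t ** X t"]
  by (auto simp: krein_solution_def)

subsection \<open>Chirped potentials\<close>

definition chirp :: "real \<Rightarrow> real \<Rightarrow> real \<Rightarrow> complex" where
  "chirp e \<nu> t = (if t \<in> {0..\<nu>\<^sup>2} then of_real (e / \<nu>) * cis (- (t\<^sup>2 / (2 * \<nu>\<^sup>2))) else 0)"

lemma krein_solution_krein_X_chirp:
  assumes "0 < e" "0 < \<nu>"
  shows "krein_solution (chirp e \<nu>) k (\<lambda>x. krein_X x k (chirp e \<nu>))"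
proof -
  have "\<exists>X. krein_solution (chirp e \<nu>) k X"
    unfolding chirp_def
    by (rule krein_solution_exists[where m = "e / \<nu>"])
      (use assms in \<open>auto intro!: continuous_intros simp: norm_mult norm_divide\<close>)
  then show ?thesis unfolding krein_X_def by (rule someI_ex)
qed

text \<open>
  The factor \<open>cis (- (u\<^sup>2/2))\<close> passes to the frame rotating with the chirp, which makes the
  coupling constant and moves the phase into the linearly varying detuning.
\<close>

lemma landau_zener_chirp:
  assumes e: "0 < e" "e \<le> 1/16" and \<nu>: "0 < \<nu>"
  shows "landau_zener e (\<nu> * s) \<nu>
    (\<lambda>u. cis (- (u\<^sup>2/2)) * krein_X (\<nu> * u) (of_real s) (chirp e \<nu>) $ 1 $ 2)
    (\<lambda>u. krein_frakA (\<nu> * u) (of_real s) (chirp e \<nu>))"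
proof -
  define X where "X x = krein_X x (of_real s) (chirp e \<nu>)" for x
  have sol: "krein_solution (chirp e \<nu>) (of_real s) X"
    unfolding X_def by (rule krein_solution_krein_X_chirp[OF e(1) \<nu>])
  have "continuous_on {0..\<nu>\<^sup>2} (\<lambda>t. of_real (e / \<nu>) * cis (- (t\<^sup>2 / (2 * \<nu>\<^sup>2))))"
    using \<nu> by (intro continuous_intros) auto
  then have cont: "continuous_on {0..\<nu>\<^sup>2} (chirp e \<nu>)"
    by (rule continuous_on_eq) (simp add: chirp_def)
  have D: "((\<lambda>u. X (\<nu> * u)) has_vector_derivative \<nu> *\<^sub>R (krein_matrix (chirp e \<nu>) (of_real s) (\<nu> * u) ** X (\<nu> * u)))
      (at u within {0..\<nu>})" if u: "u \<in> {0..\<nu>}" for u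
  proof -
    have im: "(\<lambda>u. \<nu> * u) ` {0..\<nu>} = {0..\<nu>\<^sup>2}"
      using \<nu> by (simp add: image_mult_atLeastAtMost power2_eq_square)
    have "(X has_vector_derivative (krein_matrix (chirp e \<nu>) (of_real s) (\<nu> * u) ** X (\<nu> * u)))
        (at (\<nu> * u) within (\<lambda>u. \<nu> * u) ` {0..\<nu>})"
      unfolding im by (rule krein_solution_has_vector_derivative[OF sol cont])
        (use u im in blast)
    moreover have "((\<lambda>u. \<nu> * u) has_vector_derivative \<nu>) (at u within {0..\<nu>})"
      by (auto intro!: derivative_eq_intros)
    ultimately show ?thesis
      using vector_diff_chain_within[of "\<lambda>u. \<nu> * u" \<nu> u "{0..\<nu>}" X] by (simp add: o_def)
  qed
  have D': "((\<lambda>u. X (\<nu> * u) $ i $ 2) has_vector_derivative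
      of_real \<nu> * (krein_matrix (chirp e \<nu>) (of_real s) (\<nu> * u) ** X (\<nu> * u)) $ i $ 2) (at u within {0..\<nu>})"
    if u: "u \<in> {0..\<nu>}" for u i
  proof -
    have "((\<lambda>u. X (\<nu> * u) $ i $ 2) has_vector_derivative
        \<nu> *\<^sub>R (krein_matrix (chirp e \<nu>) (of_real s) (\<nu> * u) ** X (\<nu> * u)) $ i $ 2) (at u within {0..\<nu>})"
      using bounded_linear.has_vector_derivative[OF bounded_linear_vec_nth[of 2]
          bounded_linear.has_vector_derivative[OF bounded_linear_vec_nth[of i] D[OF u]]]
      by (simp only: vector_scaleR_component)
    then show ?thesis by (simp only: scaleR_conv_of_real)
  qed
  have chirp: "chirp e \<nu> (\<nu> * u) = of_real (e / \<nu>) * cis (- (u\<^sup>2/2))" if u: "u \<in> {0..\<nu>}" for u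
    using u \<nu> by (simp add: chirp_def power_mult_distrib power2_eq_square mult_left_mono)
  have X0: "X 0 = mat 1" by (rule krein_solution_0[OF sol])
  have cis1: "cis (- x) * cis x = 1" for x by (simp add: cis_mult)
  show ?thesis
    unfolding krein_frakA_def X_def[symmetric]
  proof
    fix u assume u: "u \<in> {0..\<nu>}"
    define c where "c = cis (- (u\<^sup>2/2))"
    have c: "((\<lambda>u. cis (- (u\<^sup>2/2))) has_vector_derivative (- u) *\<^sub>R (\<i> * c)) (at u within {0..\<nu>})"
      unfolding has_vector_derivative_def c_def
      by (auto intro!: derivative_eq_intros)
    have "((\<lambda>u. cis (- (u\<^sup>2/2)) * X (\<nu> * u) $ 1 $ 2) has_vector_derivative
       (c * (of_real \<nu> * (krein_matrix (chirp e \<nu>) (of_real s) (\<nu> * u) ** X (\<nu> * u)) $ 1 $ 2)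
        + ((- u) *\<^sub>R (\<i> * c)) * X (\<nu> * u) $ 1 $ 2)) (at u within {0..\<nu>})"
      unfolding c_def by (rule has_vector_derivative_mult[OF c[unfolded c_def] D'[OF u]])
    \<comment> \<open>The factor \<nu> from the change of time cancels the amplitude e/\<nu>, and
      the conjugate chirp is \<open>cnj c\<close>; the coupling becomes exactly e, while the phase
      derivative -u joins \<nu> s.\<close>
    also have "c * (of_real \<nu> * (krein_matrix (chirp e \<nu>) (of_real s) (\<nu> * u) ** X (\<nu> * u)) $ 1 $ 2)
        + ((- u) *\<^sub>R (\<i> * c)) * X (\<nu> * u) $ 1 $ 2
      = \<i> * of_real (\<nu> * s - u) * (c * X (\<nu> * u) $ 1 $ 2) - of_real e * (c * cnj c) * X (\<nu> * u) $ 2 $ 2"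
      unfolding krein_matrix_mult_nth chirp[OF u] c_def[symmetric] using \<nu>
      by (simp add: scaleR_conv_of_real algebra_simps)
    also have "c * cnj c = 1" by (simp add: c_def cis_cnj cis_mult)
    finally show "((\<lambda>u. cis (- (u\<^sup>2/2)) * X (\<nu> * u) $ 1 $ 2) has_vector_derivative
        \<i> * of_real (\<nu> * s - u) * (cis (- (u\<^sup>2/2)) * X (\<nu> * u) $ 1 $ 2) - of_real e * X (\<nu> * u) $ 2 $ 2)
        (at u within {0..\<nu>})"
      unfolding c_def by simp
    show "((\<lambda>u. X (\<nu> * u) $ 2 $ 2) has_vector_derivative
        - of_real e * (cis (- (u\<^sup>2/2)) * X (\<nu> * u) $ 1 $ 2)) (at u within {0..\<nu>})"
      using D'[OF u, of 2] \<nu> unfolding krein_matrix_mult_nth chirp[OF u] by (simp add: algebra_simps)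
  qed (use e X0 in \<open>auto simp: mat_def\<close>)
qed

section \<open>Bounds for log |X_22| on the real line\<close>

locale chirped_krein =
  fixes e \<nu> :: real
  assumes e: "0 < e" "e \<le> 1/16" and \<nu>: "0 < \<nu>"
begin

definition "\<beta> s u = cis (- (u\<^sup>2/2)) * krein_X (\<nu> * u) (of_real s) (chirp e \<nu>) $ 1 $ 2"
definition "a s u = krein_frakA (\<nu> * u) (of_real s) (chirp e \<nu>)"
definition "g u s = ln (cmod (a s u))"

sublocale lz: landau_zener e "\<nu> * s" \<nu> "\<beta> s" "a s" for s
  using landau_zener_chirp[OF e \<nu>, of s] unfolding \<beta>_def a_def .

lemma g_nonneg: "u \<in> {0..\<nu>} \<Longrightarrow> 0 \<le> g u s"
  unfolding g_def by (intro ln_ge_zero lz.one_le_cmod_a)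

lemma g_eq: "u \<in> {0..\<nu>} \<Longrightarrow> g u s = ln (1 + (cmod (\<beta> s u))\<^sup>2) / 2"
  using lz.cmod_a_power2[of u s] lz.one_le_cmod_a[of u s] ln_realpow[of "cmod (a s u)" 2]
  by (simp add: g_def)

lemma g_le: "u \<in> {0..\<nu>} \<Longrightarrow> g u s \<le> (cmod (\<beta> s u))\<^sup>2 / 2"
  using g_eq[of u s] ln_add_one_self_le_self[of "(cmod (\<beta> s u))\<^sup>2"] by simp

lemma g_growth:
  assumes "0 \<le> p" "p \<le> q" "q \<le> \<nu>"
  shows "g q s \<le> g p s + e * (q - p)"
proof -
  have pos: "0 < cmod (a s p)" "0 < cmod (a s q)"
    using lz.one_le_cmod_a[of p s] lz.one_le_cmod_a[of q s] assms by auto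
  have "ln ((cmod (a s q))\<^sup>2) \<le> ln ((cmod (a s p))\<^sup>2 * exp (2 * e * (q - p)))"
    using lz.cmod_a_growth[OF assms, of s] pos by (subst ln_le_cancel_iff) auto
  also have "\<dots> = ln ((cmod (a s p))\<^sup>2) + 2 * e * (q - p)"
    using pos by (subst ln_mult) auto
  finally show ?thesis
    using pos by (simp add: g_def ln_realpow)
qed

lemma g_before:
  assumes "u \<in> {0..\<nu>}" "u + 1 \<le> \<nu> * s"
  shows "g u s \<le> 13 * e\<^sup>2 / (\<nu> * s - u)\<^sup>2"
proof -
  have "(cmod (\<beta> s u))\<^sup>2 \<le> (5 * e / (\<nu> * s - u))\<^sup>2"
    using lz.cmod_\<beta>_before[OF assms] by (intro power_mono) auto
  also have "\<dots> = 25 * e\<^sup>2 / (\<nu> * s - u)\<^sup>2" by (simp add: power_divide power_mult_distrib)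
  finally have "g u s \<le> 25 * e\<^sup>2 / (\<nu> * s - u)\<^sup>2 / 2" using g_le[OF assms(1), of s] by simp
  also have "\<dots> = 25/2 * e\<^sup>2 / (\<nu> * s - u)\<^sup>2" by simp
  also have "\<dots> \<le> 13 * e\<^sup>2 / (\<nu> * s - u)\<^sup>2" by (intro divide_right_mono mult_right_mono) auto
  finally show ?thesis .
qed

lemma g_left:
  assumes "u \<in> {0..\<nu>}" "\<nu> * s \<le> - 1"
  shows "g u s \<le> 32 * e\<^sup>2 / (\<nu> * s)\<^sup>2"
proof -
  have "(cmod (\<beta> s u))\<^sup>2 \<le> (8 * e / \<bar>\<nu> * s\<bar>)\<^sup>2"
    using lz.cmod_\<beta>_left[OF assms] by (intro power_mono) auto
  also have "\<dots> = 64 * e\<^sup>2 / (\<nu> * s)\<^sup>2" by (simp add: power_divide power_mult_distrib)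
  finally show ?thesis using g_le[OF assms(1), of s] by simp
qed

text \<open>The majorant is chosen so that, multiplied by the kernel bound \<nu>, its integral over
  s does not depend on \<nu>. It also covers the last unit of time before resonance.\<close>

lemma g_ahead:
  assumes u: "u \<in> {0..\<nu>}" "1 \<le> u" and "u \<le> \<nu> * s"
  shows "g u s \<le> 2 / (1 + (\<nu> * s - u)\<^sup>2)"
proof (cases "u + 1 \<le> \<nu> * s")
  case True
  define d where "d = (\<nu> * s - u)\<^sup>2"
  have d: "1 \<le> d" unfolding d_def using True by (intro one_le_power) simp
  have "e\<^sup>2 \<le> (1/16)\<^sup>2" using e by (intro power_mono) auto
  then have "13 * e\<^sup>2 / d \<le> 1 / d"
    using d by (intro divide_right_mono) (auto simp: power_divide)
  also have "\<dots> \<le> 2 / (1 + d)" using d by (simp add: field_simps)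
  finally show ?thesis using g_before[OF u(1) True] by (simp add: d_def)
next
  case False
  \<comment> \<open>One unit before resonance \<open>g_before\<close> still applies, and one unit of
    crude growth costs at most 1/16. The hypothesis \<open>1 \<le> u\<close> keeps \<open>p\<close>
    nonnegative.\<close>
  define p where "p = \<nu> * s - 1"
  have p: "p \<in> {0..\<nu>}" "p \<le> u" "u - p \<le> 1" "\<nu> * s - p = 1" using assms False by (auto simp: p_def)
  have e2: "e\<^sup>2 \<le> (1/16)\<^sup>2" using e by (intro power_mono) auto
  have "g u s \<le> g p s + e * (u - p)" using g_growth[of p u s] p u by auto
  also have "g p s \<le> 13 * e\<^sup>2" using g_before[OF p(1), of s] p by simp
  also have "e * (u - p) \<le> 1/16 * 1" using e p by (intro mult_mono) auto
  finally have "g u s \<le> 1" using e2 by (simp add: power_divide)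
  also have "1 \<le> 2 / (1 + (\<nu> * s - u)\<^sup>2)"
  proof -
    have "(\<nu> * s - u)\<^sup>2 \<le> 1" using assms False by (intro power_le_one) auto
    then show ?thesis by (simp add: pos_le_divide_eq add_pos_nonneg)
  qed
  finally show ?thesis .
qed

text \<open>The plateau: its height is half of log (1 + |\<beta>|^2) at |\<beta>| = e/5, and it does
  not depend on \<nu>.\<close>

lemma g_behind:
  assumes "e = 1/10^8" "1000 \<le> \<nu> * s" "\<nu> * s + 1000 \<le> u" "u \<le> \<nu>"
  shows "ln (1 + e\<^sup>2 / 25) / 2 \<le> g u s"
proof -
  have u: "u \<in> {0..\<nu>}" using assms by auto
  have "e / 5 \<le> cmod (\<beta> s u)"
    by (rule lz.cmod_\<beta>_after[OF assms(1) refl assms(2-4)])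
  then have "(e / 5)\<^sup>2 \<le> (cmod (\<beta> s u))\<^sup>2" using e by (intro power_mono) auto
  then have "ln (1 + e\<^sup>2 / 25) \<le> ln (1 + (cmod (\<beta> s u))\<^sup>2)"
    by (subst ln_le_cancel_iff) (auto simp: power_divide add_pos_nonneg)
  then show ?thesis using g_eq[OF u, of s] by simp
qed

text \<open>Serves integrability only, so \<open>C\<close> may depend on \<nu>. On the bounded range
  of s crude growth is enough; beyond it, \<nu> s - u \<ge> \<nu> s/2 on the right and
  \<open>g_left\<close> on the left give quadratic decay.\<close>

lemma g_decay:
  assumes u: "u \<in> {0..\<nu>}"
  shows "\<exists>C. \<forall>s. g u s \<le> C / (1 + s\<^sup>2)"
proof (intro exI allI)
  fix s :: real
  define C1 where "C1 = \<nu> * (1 + ((2 * \<nu> + 2) / \<nu>)\<^sup>2)"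
  define C2 where "C2 = 1 + 1 / \<nu>\<^sup>2"
  have C: "0 \<le> C1" "0 \<le> C2" using \<nu> by (auto simp: C1_def C2_def)
  have pos: "0 < 1 + s\<^sup>2" by (rule add_pos_nonneg) auto
  have e2: "e\<^sup>2 \<le> (1/16)\<^sup>2" using e by (intro power_mono) auto
  have "g u s * (1 + s\<^sup>2) \<le> C1 + C2"
  proof (cases "\<bar>\<nu> * s\<bar> \<le> 2 * u + 2")
    case True
    have "g u s \<le> e * u" using g_growth[of 0 u s] u by (simp add: g_def lz.init_a)
    also have "\<dots> \<le> 1 * \<nu>" using e u by (intro mult_mono) auto
    finally have 1: "g u s \<le> \<nu>" by simp
    have "\<bar>s\<bar> \<le> (2 * \<nu> + 2) / \<nu>" using True u \<nu> by (simp add: abs_mult field_simps)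
    then have "\<bar>s\<bar>\<^sup>2 \<le> ((2 * \<nu> + 2) / \<nu>)\<^sup>2" by (intro power_mono) auto
    then have "g u s * (1 + s\<^sup>2) \<le> C1"
      unfolding C1_def using 1 \<nu> pos by (intro mult_mono) auto
    then show ?thesis using C by simp
  next
    case False
    have 1: "1 \<le> (\<nu> * s)\<^sup>2"
      using False u by (simp add: abs_le_square_iff[of 1, simplified, symmetric])
    have "g u s \<le> 1 / (\<nu> * s)\<^sup>2"
    proof (cases "0 \<le> s")
      case True
      then have "0 \<le> \<nu> * s" using \<nu> by simp
      then have s: "2 * u + 2 \<le> \<nu> * s" using False by simp
      then have "g u s \<le> 13 * e\<^sup>2 / (\<nu> * s - u)\<^sup>2" using u by (intro g_before) auto
      also have "\<dots> \<le> 13 * e\<^sup>2 / (\<nu> * s / 2)\<^sup>2"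
        using s u by (intro divide_left_mono power_mono mult_pos_pos zero_less_power) auto
      also have "\<dots> = 52 * e\<^sup>2 / (\<nu> * s)\<^sup>2" by (simp add: power_divide)
      also have "\<dots> \<le> 1 / (\<nu> * s)\<^sup>2" using e2 by (intro divide_right_mono) (auto simp: power_divide)
      finally show ?thesis .
    next
      case False': False
      then have "\<nu> * s \<le> 0" using \<nu> by (simp add: mult_le_0_iff)
      then have "\<nu> * s \<le> - 1" using False u by simp
      from g_left[OF u this] have "g u s \<le> 32 * e\<^sup>2 / (\<nu> * s)\<^sup>2" .
      also have "\<dots> \<le> 1 / (\<nu> * s)\<^sup>2" using e2 by (intro divide_right_mono) (auto simp: power_divide)
      finally show ?thesis .
    qed
    then have "g u s * (1 + s\<^sup>2) \<le> 1 / (\<nu> * s)\<^sup>2 * (1 + s\<^sup>2)" using pos by (intro mult_right_mono) auto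
    also have "\<dots> = 1 / (\<nu> * s)\<^sup>2 + 1 / \<nu>\<^sup>2"
    proof -
      have "s \<noteq> 0" using 1 by auto
      then show ?thesis using \<nu> by (simp add: field_simps power_mult_distrib)
    qed
    also have "\<dots> \<le> 1 / 1 + 1 / \<nu>\<^sup>2"
      by (intro add_right_mono frac_le 1) auto
    also have "\<dots> = C2" by (simp add: C2_def)
    finally show ?thesis using C by simp
  qed
  then show "g u s \<le> (C1 + C2) / (1 + s\<^sup>2)" using pos by (simp add: pos_le_divide_eq)
qed

lemma continuous_on_g:
  assumes u: "u \<in> {0..\<nu>}"
  shows "continuous_on UNIV (g u)"
proof -
  have "(\<nu> * exp (2 * \<nu>))-lipschitz_on UNIV (\<lambda>s. a s u)"
  proof (rule lipschitz_onI)
    fix s s'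
    have "cmod (a s u - a s' u) \<le> \<bar>\<nu> * s - \<nu> * s'\<bar> * exp (2 * \<nu>)"
      by (rule landau_zener_lipschitz_in_detuning[OF lz.landau_zener_axioms lz.landau_zener_axioms u])
    also have "\<bar>\<nu> * s - \<nu> * s'\<bar> = \<nu> * \<bar>s - s'\<bar>"
      using \<nu> by (simp add: right_diff_distrib[symmetric] abs_mult)
    finally show "dist (a s u) (a s' u) \<le> \<nu> * exp (2 * \<nu>) * dist s s'"
      by (simp add: dist_norm mult_ac)
  qed (use \<nu> in simp)
  then have "continuous_on UNIV (\<lambda>s. a s u)" by (rule lipschitz_on_continuous_on)
  moreover have "a s u \<noteq> 0" for s using lz.one_le_cmod_a[OF u, of s] by auto
  ultimately show ?thesis unfolding g_def by (intro continuous_intros) auto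
qed

text \<open>Ensures that the integral in \<open>arg_frakA\<close> is genuine and not the default
  value 0 of a non-integrable function.\<close>

lemma integrable_g_over:
  assumes u: "u \<in> {0..\<nu>}" and k: "0 < Im k"
  shows "integrable lebesgue (\<lambda>s. complex_of_real (g u s) / (complex_of_real s - k))"
proof -
  obtain C where C: "g u s \<le> C / (1 + s\<^sup>2)" for s using g_decay[OF u] by blast
  have ne: "complex_of_real s - k \<noteq> 0" for s using k by (auto simp: complex_eq_iff)
  have "continuous_on UNIV (\<lambda>s. complex_of_real (g u s) / (complex_of_real s - k))"
    using ne by (intro continuous_intros continuous_on_g u) auto
  then have meas: "(\<lambda>s. complex_of_real (g u s) / (complex_of_real s - k)) \<in> borel_measurable lborel"
    by (simp add: borel_measurable_continuous_onI)
  have "integrable lborel (\<lambda>s. C / Im k * inverse (1 + s\<^sup>2))"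
    using integrable_inverse_1_plus_square by (simp add: set_integrable_def)
  then have "integrable lborel (\<lambda>s. complex_of_real (g u s) / (complex_of_real s - k))"
  proof (rule Bochner_Integration.integrable_bound[OF _ meas], intro AE_I2)
    fix s
    have "Im k \<le> cmod (complex_of_real s - k)"
      using abs_Im_le_cmod[of "complex_of_real s - k"] k by simp
    then have "cmod (complex_of_real (g u s) / (complex_of_real s - k)) \<le> (C / (1 + s\<^sup>2)) / Im k"
      using k g_nonneg[OF u, of s] C[of s] unfolding norm_divide by (intro frac_le) auto
    also have "\<dots> = C / Im k * inverse (1 + s\<^sup>2)" by (simp add: divide_inverse mult_ac)
    also have "\<dots> \<le> norm (C / Im k * inverse (1 + s\<^sup>2))" unfolding real_norm_def by (rule abs_ge_self)
    finally show "cmod (complex_of_real (g u s) / (complex_of_real s - k)) \<le> norm (C / Im k * inverse (1 + s\<^sup>2))" .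
  qed
  then show ?thesis by (simp add: integrable_completion meas)
qed

end

subsection \<open>Lower bound for the argument\<close>

text \<open>The integrand is 2 pi times the Poisson kernel at height 1/\<nu>, so the part of the
  line right of \<xi> contributes O(1) uniformly in \<nu>.\<close>

lemma has_bochner_integral_poisson:
  fixes \<nu> \<xi> :: real
  assumes "0 < \<nu>"
  shows "has_bochner_integral lborel (\<lambda>s. 2 * \<nu> / (1 + (\<nu> * (s - \<xi>))\<^sup>2)) (2 * pi)"
proof -
  have "has_bochner_integral lborel (\<lambda>x::real. inverse (1 + x\<^sup>2)) pi"
    using integrable_inverse_1_plus_square LBINT_inverse_1_plus_square
    by (simp add: has_bochner_integral_iff set_integrable_def interval_lebesgue_integral_def set_lebesgue_integral_def)
  then have "has_bochner_integral lborel (\<lambda>s. inverse (1 + (- \<nu> * \<xi> + \<nu> * s)\<^sup>2)) (pi / \<nu>)"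
    using lborel_has_bochner_integral_real_affine_iff[of \<nu> "\<lambda>x. inverse (1 + x\<^sup>2)" pi "- \<nu> * \<xi>"] assms
    by (simp add: field_simps)
  then have "has_bochner_integral lborel (\<lambda>s. 2 * \<nu> * inverse (1 + (- \<nu> * \<xi> + \<nu> * s)\<^sup>2)) (2 * \<nu> * (pi / \<nu>))"
    by (rule has_bochner_integral_mult_right[rotated])
  also have "2 * \<nu> * (pi / \<nu>) = 2 * pi" using assms by simp
  finally show ?thesis by (simp add: divide_inverse right_diff_distrib)
qed

lemma has_bochner_integral_inverse_distance:
  fixes p q \<xi> :: real
  assumes "p \<le> q" "q < \<xi>"
  shows "has_bochner_integral lborel (\<lambda>s. indicator {p..q} s * (1 / (\<xi> - s))) (ln (\<xi> - p) - ln (\<xi> - q))"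
proof -
  have "has_bochner_integral lborel (\<lambda>s. indicator {p..q} s *\<^sub>R (1 / (\<xi> - s)))
      (- ln (\<xi> - q) - (- ln (\<xi> - p)))"
  proof (rule has_bochner_integral_FTC_Icc[OF assms(1)])
    fix s assume s: "p \<le> s" "s \<le> q"
    show "((\<lambda>s. - ln (\<xi> - s)) has_vector_derivative 1 / (\<xi> - s)) (at s within {p..q})"
      unfolding has_real_derivative_iff_has_vector_derivative[symmetric]
      using s assms by (auto intro!: derivative_eq_intros)
  next
    show "continuous_on {p..q} (\<lambda>s. 1 / (\<xi> - s))"
      using assms by (intro continuous_intros) auto
  qed
  then show ?thesis by simp
qed

context chirped_krein
begin

text \<open>Division by \<i> turns the imaginary part into minus a real part, and the real part of
  1/(s - k) is the conjugate Poisson kernel up to sign and normalization.\<close>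

lemma arg_frakA_eq:
  assumes u: "u \<in> {0..\<nu>}" and k: "0 < Im k"
  shows "arg_frakA (\<nu> * u) k (chirp e \<nu>)
    = - (LINT s|lborel. g u s * ((s - Re k) / ((s - Re k)\<^sup>2 + (Im k)\<^sup>2))) / pi"
    and "integrable lborel (\<lambda>s. g u s * ((s - Re k) / ((s - Re k)\<^sup>2 + (Im k)\<^sup>2)))"
proof -
  let ?f = "\<lambda>s. complex_of_real (g u s) / (complex_of_real s - k)"
  have Re_f: "Re (?f s) = g u s * ((s - Re k) / ((s - Re k)\<^sup>2 + (Im k)\<^sup>2))" for s
    by (simp add: Re_divide)
  have ne: "complex_of_real s - k \<noteq> 0" for s using k by (auto simp: complex_eq_iff)
  have "continuous_on UNIV ?f"
    using ne by (intro continuous_intros continuous_on_g u) auto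
  then have meas: "?f \<in> borel_measurable lborel"
    by (simp add: borel_measurable_continuous_onI)
  have int: "integrable lborel ?f"
    using integrable_g_over[OF assms] integrable_completion[OF meas] by simp
  have "arg_frakA (\<nu> * u) k (chirp e \<nu>) = Im (1 / (complex_of_real pi * \<i>) * (LINT s|lborel. ?f s))"
    unfolding arg_frakA_def using integral_completion[OF meas] by (simp add: g_def a_def)
  also have "\<dots> = - Re (LINT s|lborel. ?f s) / pi"
    by (simp add: Im_divide power2_eq_square)
  also have "Re (LINT s|lborel. ?f s) = (LINT s|lborel. Re (?f s))"
    by (rule integral_Re[symmetric, OF int])
  finally show "arg_frakA (\<nu> * u) k (chirp e \<nu>)
    = - (LINT s|lborel. g u s * ((s - Re k) / ((s - Re k)\<^sup>2 + (Im k)\<^sup>2))) / pi"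
    unfolding Re_f .
  show "integrable lborel (\<lambda>s. g u s * ((s - Re k) / ((s - Re k)\<^sup>2 + (Im k)\<^sup>2)))"
    using integrable_Re[OF int] unfolding Re_f .
qed

text \<open>The integrand is compared pointwise with a function of known integral. \<open>c\<close>
  is half the plateau height: the other factor 1/2 is lost in replacing the kernel by 1/(\<xi> -
  s).\<close>

lemma arg_frakA_lower_bound:
  assumes e: "e = 1/10^8" and \<nu>4: "4000 \<le> \<nu>" and \<xi>: "\<xi> \<in> {1/2..1}"
  defines "c \<equiv> ln (1 + e\<^sup>2 / 25) / 4"
  shows "(c * ln (\<nu> / 4000) - 2 * pi) / pi \<le> arg_frakA (\<nu> * (\<nu> * \<xi>)) (Complex \<xi> (1 / \<nu>)) (chirp e \<nu>)"
proof -
  define u where "u = \<nu> * \<xi>"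
  have u: "u \<in> {0..\<nu>}" "1 \<le> u" using \<xi> \<nu>4 mult_mono[of 4000 \<nu> "1/2" \<xi>] by (auto simp: u_def mult_left_le)
  \<comment> \<open>For s \<le> q the resonance lies at least 1000 units of time back. The lower end
    1/4 and \<nu> \<ge> 4000 place it at least 1000 units after the start.\<close>
  define q where "q = \<xi> - 1000 / \<nu>"
  have "1000 / \<nu> \<le> 1/4" using \<nu>4 by (simp add: field_simps)
  then have q: "1/4 \<le> q" "q < \<xi>"
    using \<xi> \<nu> unfolding q_def atLeastAtMost_iff by linarith (simp add: \<nu>)
  have c: "0 \<le> c" by (simp add: c_def)
  define K where "K s = (s - \<xi>) / ((s - \<xi>)\<^sup>2 + (1 / \<nu>)\<^sup>2)" for s
  \<comment> \<open>A bump for s right of \<xi> and minus the logarithmic kernel on the plateau.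
    Elsewhere on the left the integrand is nonpositive, since g \<ge> 0, and is simply
    dropped.\<close>
  define H where "H s = 2 * \<nu> / (1 + (\<nu> * (s - \<xi>))\<^sup>2) - c * (indicator {1/4..q} s * (1 / (\<xi> - s)))" for s
  have H: "has_bochner_integral lborel H (2 * pi - c * (ln (\<xi> - 1/4) - ln (\<xi> - q)))"
    unfolding H_def
    by (intro has_bochner_integral_diff has_bochner_integral_mult_right
        has_bochner_integral_poisson[OF \<nu>] has_bochner_integral_inverse_distance q)
  have denom: "0 < (s - \<xi>)\<^sup>2 + (1 / \<nu>)\<^sup>2" for s using \<nu> by (intro add_nonneg_pos) auto
  have le: "g u s * K s \<le> H s" for s
  proof (cases "\<xi> \<le> s")
    case True
    have "u \<le> \<nu> * s" unfolding u_def using True \<nu> by (intro mult_left_mono) auto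
    then have g: "g u s \<le> 2 / (1 + (\<nu> * (s - \<xi>))\<^sup>2)"
      using g_ahead[OF u, of s] by (simp add: u_def right_diff_distrib)
    have "2 * (s - \<xi>) * (1 / \<nu>) \<le> (s - \<xi>)\<^sup>2 + (1 / \<nu>)\<^sup>2" by (rule sum_squares_bound)
    then have "s - \<xi> \<le> \<nu> / 2 * ((s - \<xi>)\<^sup>2 + (1 / \<nu>)\<^sup>2)"
      using \<nu> by (simp add: field_simps)
    also have "\<dots> \<le> \<nu> * ((s - \<xi>)\<^sup>2 + (1 / \<nu>)\<^sup>2)"
      using denom[of s] \<nu> by (intro mult_right_mono) auto
    finally have "K s \<le> \<nu>"
      unfolding K_def using denom[of s] by (simp add: pos_divide_le_eq)
    moreover have "0 \<le> K s" unfolding K_def using True denom[of s] by simp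
    ultimately have "g u s * K s \<le> 2 / (1 + (\<nu> * (s - \<xi>))\<^sup>2) * \<nu>"
      using g g_nonneg[OF u(1), of s] by (intro mult_mono) auto
    also have "\<dots> = H s" using True q by (simp add: H_def mult.commute)
    finally show ?thesis .
  next
    case False
    have pos: "0 \<le> 2 * \<nu> / (1 + (\<nu> * (s - \<xi>))\<^sup>2)" using \<nu> by (intro divide_nonneg_nonneg) auto
    have K: "K s \<le> 0" unfolding K_def using False denom[of s] by (simp add: divide_le_0_iff)
    show ?thesis
    proof (cases "s \<in> {1/4..q}")
      case True
      have d: "1000 / \<nu> \<le> \<xi> - s" using True by (simp add: q_def)
      have d': "1 / \<nu> \<le> \<xi> - s" using d \<nu> order_trans[of "1/\<nu>" "1000/\<nu>"] by (simp add: divide_right_mono)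
      have "1000 \<le> \<nu> * s" using True \<nu>4 mult_mono[of 4000 \<nu> "1/4" s] by auto
      moreover have "\<nu> * s + 1000 \<le> u"
        using d \<nu> by (simp add: u_def field_simps)
      ultimately have "2 * c \<le> g u s"
        using g_behind[OF e, of s u] u by (simp add: c_def)
      moreover have "1 / (\<xi> - s) / 2 \<le> - K s"
      proof -
        have "(1 / \<nu>)\<^sup>2 \<le> (\<xi> - s)\<^sup>2" using d' \<nu> by (intro power_mono) auto
        then have le: "(s - \<xi>)\<^sup>2 + (1 / \<nu>)\<^sup>2 \<le> 2 * (\<xi> - s)\<^sup>2" by (simp add: power2_commute)
        have "1 / d / 2 = d / (2 * d\<^sup>2)" for d :: real
          by (simp add: power2_eq_square)
        then have "1 / (\<xi> - s) / 2 = (\<xi> - s) / (2 * (\<xi> - s)\<^sup>2)" .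
        also have "(\<xi> - s) / (2 * (\<xi> - s)\<^sup>2) \<le> (\<xi> - s) / ((s - \<xi>)\<^sup>2 + (1 / \<nu>)\<^sup>2)"
          using False denom[of s] le by (intro divide_left_mono mult_pos_pos) auto
        also have "\<dots> = - K s" by (simp add: K_def minus_divide_left)
        finally show ?thesis .
      qed
      ultimately have "2 * c * (1 / (\<xi> - s) / 2) \<le> g u s * (- K s)"
        using c False by (intro mult_mono) auto
      moreover have "2 * c * (x / 2) = c * x" for x by simp
      ultimately have "c * (1 / (\<xi> - s)) \<le> - (g u s * K s)" by (simp only: mult_minus_right)
      then have "g u s * K s \<le> - (c * (1 / (\<xi> - s)))" by linarith
      also have "\<dots> \<le> H s" using True pos by (simp add: H_def)
      finally show ?thesis .
    next
      case out: False
      have "g u s * K s \<le> 0" using K g_nonneg[OF u(1), of s] by (rule mult_nonneg_nonpos[rotated])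
      also have "\<dots> \<le> H s" using out pos by (simp add: H_def)
      finally show ?thesis .
    qed
  qed
  have k: "0 < Im (Complex \<xi> (1 / \<nu>))" using \<nu> by simp
  have "integrable lborel (\<lambda>s. g u s * K s)"
    using arg_frakA_eq(2)[OF u(1) k] by (simp add: K_def)
  then have "(LINT s|lborel. g u s * K s) \<le> (LINT s|lborel. H s)"
    using H le by (intro integral_mono) (auto simp: has_bochner_integral_iff)
  also have "\<dots> = 2 * pi - c * (ln (\<xi> - 1/4) - ln (\<xi> - q))"
    using H by (rule has_bochner_integral_integral_eq)
  also have "\<dots> \<le> 2 * pi - c * ln (\<nu> / 4000)"
  proof -
    \<comment> \<open>This is where \<xi> \<ge> 1/2 enters: the plateau reaches from distance
      1000/\<nu> to distance at least 1/4, a ratio of at least \<nu>/4000.\<close>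
    have "ln (1/4) \<le> ln (\<xi> - 1/4)" using \<xi> by (subst ln_le_cancel_iff) auto
    moreover have "ln (1/4 / (\<nu> / 4000)) = ln (1/4) - ln (\<nu> / 4000)"
      by (rule ln_divide_pos) (use \<nu> in auto)
    moreover have "1/4 / (\<nu> / 4000) = \<xi> - q" by (simp add: q_def)
    ultimately have "ln (\<nu> / 4000) \<le> ln (\<xi> - 1/4) - ln (\<xi> - q)" by simp
    then show ?thesis using c by (intro diff_left_mono mult_left_mono)
  qed
  finally have "(c * ln (\<nu> / 4000) - 2 * pi) / pi \<le> - (LINT s|lborel. g u s * K s) / pi"
    by (intro divide_right_mono) auto
  also have "\<dots> = arg_frakA (\<nu> * u) (Complex \<xi> (1 / \<nu>)) (chirp e \<nu>)"
    using arg_frakA_eq(1)[OF u(1) k] by (simp add: K_def)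
  finally show ?thesis by (simp only: u_def)
qed

end

section \<open>Measurability, norms and conclusion\<close>

text \<open>For fixed k, membership in the Stolz angle is an open condition on the vertex, so the
  maximal function is lower semicontinuous. Measurability matters because \<open>emeasure\<close> is
  0 on non-measurable sets, which would break monotonicity.\<close>

lemma sets_frakM_ge: "{\<xi>. l \<le> frakM \<xi> A} \<in> sets lebesgue"
proof -
  have gt: "open {\<xi>. y < frakM \<xi> A}" for y
  proof -
    have "{\<xi>. y < frakM \<xi> A}
      = (\<Union>(k, x) \<in> {(k, x). 0 < Im k \<and> 0 \<le> x \<and> y < ereal \<bar>arg_frakA x k A\<bar>}. {\<xi>. \<bar>Re k - \<xi>\<bar> < Im k})"
      by (auto simp: frakM_def less_SUP_iff stolz_angle_def)
    moreover have "open {\<xi>. \<bar>r - \<xi>\<bar> < i}" for r i :: real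
      by (intro open_Collect_less continuous_intros)
    ultimately show ?thesis by auto
  qed
  have "(\<lambda>\<xi>. frakM \<xi> A) \<in> borel_measurable borel"
    by (rule borel_measurableI_greater) (use gt in auto)
  then have "{\<xi> \<in> space borel. l \<le> frakM \<xi> A} \<in> sets borel" by measurable
  then show ?thesis by simp
qed

lemma chirp_L2:
  assumes "0 < e" "0 < \<nu>"
  shows "chirp e \<nu> \<in> L2_halfline" "L2_halfline_norm (chirp e \<nu>) = e"
    "compactly_supported_halfline (chirp e \<nu>)"
proof -
  have sq: "(cmod (chirp e \<nu> x))\<^sup>2 = (e / \<nu>)\<^sup>2 * indicator {0..\<nu>\<^sup>2} x" for x
    using assms by (auto simp: chirp_def norm_mult norm_divide)
  have "continuous_on UNIV (\<lambda>t. of_real (e / \<nu>) * cis (- (t\<^sup>2 / (2 * \<nu>\<^sup>2))))"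
    using assms by (intro continuous_intros) auto
  then have "(\<lambda>t. of_real (e / \<nu>) * cis (- (t\<^sup>2 / (2 * \<nu>\<^sup>2)))) \<in> borel_measurable borel"
    by (rule borel_measurable_continuous_onI)
  then have "chirp e \<nu> \<in> borel_measurable borel"
    unfolding chirp_def by measurable
  then have "(\<lambda>x. indicator {0..} x *\<^sub>R chirp e \<nu> x) \<in> borel_measurable borel" by measurable
  then have meas: "set_borel_measurable lebesgue {0..} (chirp e \<nu>)"
    unfolding set_borel_measurable_def by (intro measurable_completion) simp
  have eq: "indicator {0..} x *\<^sub>R (cmod (chirp e \<nu> x))\<^sup>2 = (e / \<nu>)\<^sup>2 * indicator {0..\<nu>\<^sup>2} x" for x :: real
    by (auto simp: sq indicator_def)
  have int: "has_bochner_integral lebesgue (\<lambda>x. (e / \<nu>)\<^sup>2 * indicator {0..\<nu>\<^sup>2} x) ((e / \<nu>)\<^sup>2 * measure lebesgue {0..\<nu>\<^sup>2})"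
    by (intro has_bochner_integral_mult_right has_bochner_integral_real_indicator) auto
  have "set_integrable lebesgue {0..} (\<lambda>x. (cmod (chirp e \<nu> x))\<^sup>2)"
    using int unfolding set_integrable_def eq by (rule has_bochner_integral_iff[THEN iffD1, THEN conjunct1])
  then show "chirp e \<nu> \<in> L2_halfline"
    using meas unfolding L2_halfline_def by blast
  have "(LINT x:{0..}|lebesgue. (cmod (chirp e \<nu> x))\<^sup>2) = e\<^sup>2"
    unfolding set_lebesgue_integral_def eq has_bochner_integral_integral_eq[OF int]
    using assms by (simp add: power_divide)
  then show "L2_halfline_norm (chirp e \<nu>) = e"
    using assms by (simp add: L2_halfline_norm_def)
  have "bounded {x \<in> {0..}. chirp e \<nu> x \<noteq> 0}"
    by (rule bounded_subset[of "{0..\<nu>\<^sup>2}"]) (auto simp: chirp_def split: if_splits)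
  then show "compactly_supported_halfline (chirp e \<nu>)"
    unfolding compactly_supported_halfline_def by (simp add: compact_closure)
qed

theorem theorem1p2:
  shows "(\<exists>C>0. \<exists>C'>0. \<exists>c>0. \<exists>\<Psi> :: nat \<Rightarrow> real \<Rightarrow> complex.
            \<forall>n\<ge>1. \<Psi> n \<in> L2_halfline \<and>
                   compactly_supported_halfline (\<Psi> n) \<and>
                   L2_halfline_norm (\<Psi> n) < C \<and>
                   emeasure lebesgue {\<xi>::real. frakM \<xi> (\<Psi> n) \<ge> ereal (C' * ln (real n))} \<ge> ennreal c)
       \<and> \<not> (\<exists>K::real. \<forall>l>0. \<forall>A\<in>L2_halfline.
              emeasure lebesgue {\<xi>::real. frakM \<xi> A \<ge> ereal l} \<le> ennreal (K * L2_halfline_norm A / l))"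
proof -
  define e where "e = (1/10^8 :: real)"
  define c where "c = ln (1 + e\<^sup>2 / 25) / 4"
  \<comment> \<open>The exponential absorbs the additive loss 2 pi, so the bound is exactly
    \<open>C' * ln (real n)\<close> for every n \<ge> 1, without a threshold.\<close>
  define B where "B = 4000 * exp (2 * pi / c)"
  define \<Psi> where "\<Psi> n = chirp e (B * real n)" for n :: nat
  define C' where "C' = c / pi"
  have e: "0 < e" "e \<le> 1/16" by (simp_all add: e_def)
  have c: "0 < c" unfolding c_def using e by (intro divide_pos_pos ln_gt_zero) auto
  have C': "0 < C'" using c by (simp add: C'_def)
  have B: "4000 \<le> B" using c by (simp add: B_def)
  have L2: "\<Psi> n \<in> L2_halfline" "compactly_supported_halfline (\<Psi> n)" "L2_halfline_norm (\<Psi> n) = e"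
    if "1 \<le> n" for n
    using chirp_L2[OF e(1), of "B * real n"] B that by (auto simp: \<Psi>_def)
  have large: "ennreal (1/2) \<le> emeasure lebesgue {\<xi>. ereal (C' * ln (real n)) \<le> frakM \<xi> (\<Psi> n)}"
    if n: "1 \<le> n" for n
  proof -
    define \<nu> where "\<nu> = B * real n"
    have \<nu>4: "4000 \<le> \<nu>" using B n mult_mono[of 4000 B 1 "real n"] by (simp add: \<nu>_def)
    interpret chirped_krein e \<nu> by unfold_locales (use e \<nu>4 in auto)
    have "ereal (C' * ln (real n)) \<le> frakM \<xi> (\<Psi> n)" if \<xi>: "\<xi> \<in> {1/2..1}" for \<xi>
    proof -
      have "ln (\<nu> / 4000) = 2 * pi / c + ln (real n)"
        using n by (simp add: \<nu>_def B_def ln_mult)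
      then have "(c * ln (\<nu> / 4000) - 2 * pi) / pi = C' * ln (real n)"
        using c by (simp add: C'_def distrib_left)
      then have "C' * ln (real n) \<le> \<bar>arg_frakA (\<nu> * (\<nu> * \<xi>)) (Complex \<xi> (1 / \<nu>)) (\<Psi> n)\<bar>"
        using arg_frakA_lower_bound[OF e_def \<nu>4 \<xi>] unfolding c_def[symmetric] \<Psi>_def \<nu>_def[symmetric] by simp
      also have "ereal \<dots> \<le> frakM \<xi> (\<Psi> n)"
        unfolding frakM_def
        \<comment> \<open>The point \<xi> + \<i>/\<nu> lies on the axis of the Stolz angle at \<xi>;
          the time depends on \<xi>, which the supremum over x permits.\<close>
        by (rule SUP_upper2[where i = "(Complex \<xi> (1 / \<nu>), \<nu> * (\<nu> * \<xi>))"])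
          (use \<nu>4 \<xi> in \<open>auto simp: stolz_angle_def\<close>)
      finally show ?thesis by simp
    qed
    then have "emeasure lebesgue {1/2..1::real} \<le> emeasure lebesgue {\<xi>. ereal (C' * ln (real n)) \<le> frakM \<xi> (\<Psi> n)}"
      by (intro emeasure_mono sets_frakM_ge) auto
    then show ?thesis by simp
  qed
  have "\<not> (\<forall>l>0. \<forall>A\<in>L2_halfline.
      emeasure lebesgue {\<xi>. ereal l \<le> frakM \<xi> A} \<le> ennreal (K * L2_halfline_norm A / l))" for K
  proof
    assume K: "\<forall>l>0. \<forall>A\<in>L2_halfline.
      emeasure lebesgue {\<xi>. ereal l \<le> frakM \<xi> A} \<le> ennreal (K * L2_halfline_norm A / l)"
    have "filterlim (\<lambda>n. C' * ln (real n)) at_top sequentially"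
      using C' by (intro filterlim_tendsto_pos_mult_at_top[OF tendsto_const]
          filterlim_compose[OF ln_at_top] filterlim_real_sequentially)
    \<comment> \<open>The 1 makes the level positive, as the weak-type bound requires. The other
      term pushes its right-hand side down to 1/3, below the measure 1/2 of [1/2, 1].\<close>
    then have "\<forall>\<^sub>F n in sequentially. max 1 (3 * \<bar>K\<bar> * e) \<le> C' * ln (real n) \<and> 1 \<le> n"
      unfolding filterlim_at_top by (intro eventually_conj eventually_ge_at_top) blast
    then obtain n where n: "max 1 (3 * \<bar>K\<bar> * e) \<le> C' * ln (real n)" "1 \<le> n"
      using eventually_happens' sequentially_bot by blast
    have "ennreal (1/2) \<le> ennreal (K * L2_halfline_norm (\<Psi> n) / (C' * ln (real n)))"
      by (rule order_trans[OF large K[rule_format]]) (use n L2 in auto)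
    also have "\<dots> \<le> ennreal (1/3)"
    proof (rule ennreal_leI)
      have "K * e \<le> \<bar>K\<bar> * e" using e by (intro mult_right_mono) auto
      then have "3 * (K * e) \<le> C' * ln (real n)" using n(1) by simp
      then show "K * L2_halfline_norm (\<Psi> n) / (C' * ln (real n)) \<le> 1/3"
        using n L2(3)[OF n(2)] by (simp add: pos_divide_le_eq)
    qed
    finally have "(1/2 :: real) \<le> 1/3" by (rule ennreal_le_iff[THEN iffD1, rotated]) simp
    then show False by simp
  qed
  moreover have "e < 1" by (simp add: e_def)
  ultimately show ?thesis
    using C' L2 large
    by (intro conjI exI[of _ "1::real"] exI[of _ C'] exI[of _ "1/2::real"] exI[of _ \<Psi>]) auto
qed

end
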